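(* Let $p\ge 4$. Let $\mathcal{C}$ be a $C^4$ curve and let $\mathbf{v}^0$ be initial data on $\mathcal{C}$. If the $(S_p,S_{p-2})$ normal multi-scale transform for $\mathcal{C}$ with initial data $\mathbf{v}^0$ is well-posed and convergent, then the normal re-parametrization is $C^{3,1-}$.
   Context: Curve. $\mathcal{C}$ is a rectifiable, non-self-intersecting, closed planar curve of length $L$, given by its regular $C^1$ arc-length parametrization $\mathbf{v}(s)$, $s\in[0,L]$, extended $L$-periodically to $\mathbb{R}$. "$\mathcal{C}$ is $C^k$" means that $\mathbf{v}$ is $C^k$ (as a periodic function). Initial data. $\mathbf{v}^0_i=\mathbf{v}(s^0_i)$, $i=0,\dots,N-1$, with $s^0_0<s^0_1<\dots<s^0_{N-1}<s^0_0+L$, extended by $\mathbf{v}^0_{i+N}=\mathbf{v}^0_i$, $s^0_{i+N}=s^0_i+L$ for all $i\in\mathbb{Z}$. Subdivision operators. On sequences indexed by $\mathbb{Z}$ (componentwise for $\mathbb{R}^2$-valued ones), $(S_0x)_{2i}=(S_0x)_{2i+1}=x_i$ and $(S_px)_i=\frac12\big((S_{p-1}x)_i+(S_{p-1}x)_{i+1}\big)$ for $p\ge1$. Notation. $\Delta x_i=x_{i+1}-x_i$; $I=\{0,1,\dots,p+1\}$, $I_i=i+I$; $\perp$ is rotation by $\pi/2$ in a fixed direction. $(S_p,S_{p-2})$ normal multi-scale transform. For $j\ge1$ and $K\in\mathbb{Z}$ one sets $$\mathbf{v}^j_K=(S_p\mathbf{v}^{j-1})_K+d^j_K\hat{\mathbf{n}}^j_K,\qquad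 \hat{\mathbf{n}}^j_K=\frac{(S_{p-2}\Delta\mathbf{v}^{j-1})_K^\perp}{|(S_{p-2}\Delta\mathbf{v}^{j-1})_K|},$$ where the scalar $d^j_K$ is such that $\mathbf{v}^j_K=\mathbf{v}(s^j_K)$ lies on $\mathcal{C}$. If the line $(S_p\mathbf{v}^{j-1})_K+t\hat{\mathbf{n}}^j_K$, $t\in\mathbb{R}$, has several intersection points with $\mathcal{C}$, one always takes a point whose parameter satisfies $s^j_K\in[s^{j-1}_i,s^{j-1}_{i+p+1}]$ (the interval spanned by $s^{j-1}|_{I_i}$) for the indices $i$ with $K\in I_{2i}\cup I_{2i+1}$. One has $s^j_{i+2^jN}=s^j_i+L$. The transform is well-posed if all $\mathbf{v}^j$ and $\hat{\mathbf{n}}^j$ exist and each $s^j$ is strictly increasing. It is convergent if the piecewise linear interpolants $s^j(t)$, with $s^j(2^{-j}i)=s^j_i$, converge uniformly as $j\to\infty$ to a continuous function $s(t)$. The normal re-parametrization of $\mathcal{C}$ is $t\mapsto\mathbf{v}(s(t))$ (the limit of the piecewise linear interpolants of $\mathbf{v}^j$ on the grids $2^{-j}\mathbb{Z}$). $C^{k,1-}$ means $C^{k,\alpha}$ (Hölder) for all $\alpha\in(0,1)$. *)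

theory Defs
  imports "HOL-Analysis.Analysis"
begin

text \<open>The plane is modelled by the type of complex numbers. Sequences indexed by the integers have
  type \<open>int \<Rightarrow> 'a\<close>.\<close>

section \<open>Smoothness of functions of a real variable\<close>

definition nth_vderiv :: "nat \<Rightarrow> (real \<Rightarrow> 'a::real_normed_vector) \<Rightarrow> real \<Rightarrow> 'a" where
  "nth_vderiv k f = ((\<lambda>g t. vector_derivative g (at t)) ^^ k) f"

definition C_k :: "nat \<Rightarrow> (real \<Rightarrow> 'a::real_normed_vector) \<Rightarrow> bool" where
  "C_k k f \<longleftrightarrow>
     (\<forall>i<k. \<forall>t. nth_vderiv i f differentiable (at t)) \<and> continuous_on UNIV (nth_vderiv k f)"

text \<open>All functions of interest are periodic, so their derivatives are bounded as soon as they are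
  continuous, and the local and the global Hoelder conditions agree.\<close>

definition holder_continuous :: "real \<Rightarrow> (real \<Rightarrow> 'a::real_normed_vector) \<Rightarrow> bool" where
  "holder_continuous \<alpha> f \<longleftrightarrow> (\<exists>B. \<forall>x y. norm (f x - f y) \<le> B * \<bar>x - y\<bar> powr \<alpha>)"

definition C_k_holder :: "nat \<Rightarrow> real \<Rightarrow> (real \<Rightarrow> 'a::real_normed_vector) \<Rightarrow> bool" where
  "C_k_holder k \<alpha> f \<longleftrightarrow> C_k k f \<and> holder_continuous \<alpha> (nth_vderiv k f)"

definition C_k_1minus :: "nat \<Rightarrow> (real \<Rightarrow> 'a::real_normed_vector) \<Rightarrow> bool" where
  "C_k_1minus k f \<longleftrightarrow> (\<forall>\<alpha>\<in>{0<..<1}. C_k_holder k \<alpha> f)"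

section \<open>Curve and initial data\<close>

text \<open>Rectifiability and the fact that the length is \<open>L\<close> follow from the unit speed condition.\<close>

definition closed_arclength_curve :: "(real \<Rightarrow> complex) \<Rightarrow> real \<Rightarrow> bool" where
  "closed_arclength_curve v L \<longleftrightarrow>
     0 < L \<and> C_k 1 v \<and> (\<forall>t. norm (vector_derivative v (at t)) = 1) \<and>
     (\<forall>t. v (t + L) = v t) \<and> inj_on v {0..<L}"

definition initial_data ::
  "(real \<Rightarrow> complex) \<Rightarrow> real \<Rightarrow> nat \<Rightarrow> (int \<Rightarrow> real) \<Rightarrow> (int \<Rightarrow> complex) \<Rightarrow> bool" where
  "initial_data v L N s0 v0 \<longleftrightarrow>
     0 < N \<and>
     strict_mono_on {0..<int N} s0 \<and> s0 (int N - 1) < s0 0 + L \<and>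
     (\<forall>i. s0 (i + int N) = s0 i + L) \<and>
     (\<forall>i. v0 i = v (s0 i))"

section \<open>Subdivision operators\<close>

primrec subdiv :: "nat \<Rightarrow> (int \<Rightarrow> 'a::real_vector) \<Rightarrow> int \<Rightarrow> 'a" where
  "subdiv 0 x = (\<lambda>i. x (i div 2))"
| "subdiv (Suc p) x = (\<lambda>i. (1/2) *\<^sub>R (subdiv p x i + subdiv p x (i + 1)))"

definition fdiff :: "(int \<Rightarrow> 'a::ab_group_add) \<Rightarrow> int \<Rightarrow> 'a" where
  "fdiff x i = x (i + 1) - x i"

definition stencil :: "nat \<Rightarrow> int \<Rightarrow> int set" where
  "stencil p i = (\<lambda>m. i + m) ` {0..int p + 1}"

section \<open>The normal multi-scale transform\<close>

text \<open>Rotation by a right angle, taken counter-clockwise; the other choice only changes the signs of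
  the scalars \<open>d\<close>.\<close>

definition perp :: "complex \<Rightarrow> complex" where
  "perp z = \<i> * z"

definition unit_normal :: "nat \<Rightarrow> (int \<Rightarrow> complex) \<Rightarrow> int \<Rightarrow> complex" where
  "unit_normal p x K =
     perp (subdiv (p - 2) (fdiff x) K) /\<^sub>R norm (subdiv (p - 2) (fdiff x) K)"

definition line_hits :: "nat \<Rightarrow> (real \<Rightarrow> complex) \<Rightarrow> (int \<Rightarrow> complex) \<Rightarrow> int \<Rightarrow> complex set" where
  "line_hits p v x K = range (\<lambda>t::real. subdiv p x K + t *\<^sub>R unit_normal p x K) \<inter> range v"

text \<open>\<open>s j\<close>, \<open>vv j\<close>, \<open>d j\<close> are the parameters, points and details of level \<open>j\<close>; \<open>d 0\<close> is
  irrelevant. The points \<open>vv j\<close> exist because they are given; that the normals exist is part of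
  \<open>well_posed\<close> below.\<close>

definition normal_transform ::
  "nat \<Rightarrow> (real \<Rightarrow> complex) \<Rightarrow> real \<Rightarrow> nat \<Rightarrow> (int \<Rightarrow> complex) \<Rightarrow>
   (nat \<Rightarrow> int \<Rightarrow> real) \<Rightarrow> (nat \<Rightarrow> int \<Rightarrow> complex) \<Rightarrow> (nat \<Rightarrow> int \<Rightarrow> real) \<Rightarrow> bool" where
  "normal_transform p v L N v0 s vv d \<longleftrightarrow>
     initial_data v L N (s 0) v0 \<and> vv 0 = v0 \<and>
     (\<forall>j K. vv (Suc j) K = subdiv p (vv j) K + d (Suc j) K *\<^sub>R unit_normal p (vv j) K) \<and>
     (\<forall>j K. vv (Suc j) K = v (s (Suc j) K)) \<and>
     (\<forall>j K. (\<exists>P\<in>line_hits p v (vv j) K. \<exists>Q\<in>line_hits p v (vv j) K. P \<noteq> Q) \<longrightarrow>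
        (\<forall>i. K \<in> stencil p (2 * i) \<union> stencil p (2 * i + 1) \<longrightarrow>
           s (Suc j) K \<in> {s j i..s j (i + int p + 1)})) \<and>
     (\<forall>j i. s j (i + 2 ^ j * int N) = s j i + L)"

definition well_posed ::
  "nat \<Rightarrow> (nat \<Rightarrow> int \<Rightarrow> real) \<Rightarrow> (nat \<Rightarrow> int \<Rightarrow> complex) \<Rightarrow> bool" where
  "well_posed p s vv \<longleftrightarrow>
     (\<forall>j K. subdiv (p - 2) (fdiff (vv j)) K \<noteq> 0) \<and> (\<forall>j. strict_mono (s j))"

definition pl_interpolant :: "nat \<Rightarrow> (int \<Rightarrow> 'a::real_vector) \<Rightarrow> real \<Rightarrow> 'a" where
  "pl_interpolant j x t =
     (let i = \<lfloor>2 ^ j * t\<rfloor>; \<theta> = 2 ^ j * t - of_int i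
      in (1 - \<theta>) *\<^sub>R x i + \<theta> *\<^sub>R x (i + 1))"

definition converges_to :: "(nat \<Rightarrow> int \<Rightarrow> real) \<Rightarrow> (real \<Rightarrow> real) \<Rightarrow> bool" where
  "converges_to s \<sigma> \<longleftrightarrow>
     continuous_on UNIV \<sigma> \<and>
     uniform_limit UNIV (\<lambda>j. pl_interpolant j (s j)) \<sigma> sequentially"

definition normal_reparametrization :: "(real \<Rightarrow> complex) \<Rightarrow> (real \<Rightarrow> real) \<Rightarrow> real \<Rightarrow> complex" where
  "normal_reparametrization v \<sigma> = (\<lambda>t. v (\<sigma> t))"

end

theory Submission
  imports Defs
begin

text \<open>Expand the curve to third order at \<open>s\<^sup>j\<^sup>+\<^sup>1\<^sub>K\<close>. Since \<open>v' \<bullet> v'' = 0\<close>, the orthogonality of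
  \<open>v\<^sup>j\<^sup>+\<^sup>1\<^sub>K - (S\<^sub>p v\<^sup>j)\<^sub>K\<close> and \<open>(S\<^sub>p\<^sub>-\<^sub>2 \<Delta>v\<^sup>j)\<^sub>K\<close> gives \<open>s\<^sup>j\<^sup>+\<^sup>1 = S\<^sub>p s\<^sup>j + O(h\<^sup>3)\<close>, where \<open>h = max \<Delta>s\<^sup>j\<close> tends to
  zero by convergence. Hence \<open>\<Delta>s\<^sup>j\<^sup>+\<^sup>1 \<le> h / 2 + O(h\<^sup>3)\<close>, which forces \<open>\<Delta>s\<^sup>j = O(2\<^sup>-\<^sup>j)\<close> and then
  \<open>\<Delta>\<^sup>2s\<^sup>j = O(4\<^sup>-\<^sup>j)\<close>. For nearly affine \<open>s\<^sup>j\<close> the remaining third order terms cancel as well, because \<open>S\<^sub>p\<close>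
  and \<open>S\<^sub>p\<^sub>-\<^sub>2 \<Delta>\<close> have the same centre and reproduce the relevant moments; this improves the error to
  \<open>O(16\<^sup>-\<^sup>j)\<close>. An \<open>O(16\<^sup>-\<^sup>j)\<close> perturbation of \<open>S\<^sub>p\<close> with \<open>p \<ge> 4\<close> keeps the scaled differences
  \<open>2\<^sup>k\<^sup>j \<Delta>\<^sup>ks\<^sup>j\<close> bounded for \<open>k \<le> 3\<close> and of size \<open>O(j)\<close> for \<open>k = 4\<close>, so their limits are the derivatives
  of \<open>\<sigma>\<close>, the third one with modulus of continuity \<open>O(j 2\<^sup>-\<^sup>j)\<close> at distance \<open>2\<^sup>-\<^sup>j\<close>.\<close>

section \<open>Subdivision operators\<close>

text \<open>Nothing bounds a single increment of \<open>s\<close> from below, so no step may divide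
  by one. All local errors are measured by the span \<open>H\<close> of the stencil of
  \<open>K\<close> instead: every increment in it enters \<open>S_{p-2} Delta s\<close> with weight
  at least \<open>2 ^ -(p - 2)\<close>, so \<open>H\<close> is at most a constant times this
  average, and one may divide by the average after projecting on the tangent.

  Convergence places a new parameter within \<open>\<epsilon>\<close> of its parent node; the
  orthogonality relation sharpens this to a multiple of \<open>H\<close>.

  Third order alone is too weak: with errors \<open>8 ^ -j\<close> the scaled second differences
  stay bounded, but this argument would let the third ones grow linearly in \<open>j\<close>, one
  derivative too early. The fourth order cancellation, however, needs nodes that are close to
  affine, and bounded scaled second differences say just that. Hence the two passes. In the second
  one, \<open>k = 4\<close> is critical: \<open>2 ^ (4 * j) / 16 ^ j\<close> is constant, each level
  may add a fixed amount, and the resulting factor \<open>j\<close>, a logarithm of the distance, is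
  absorbed by every Hoelder exponent below 1.\<close>

lemma subdiv_add: "subdiv p (\<lambda>i. x i + y i) K = subdiv p x K + subdiv p y K"
  by (induction p arbitrary: K) (auto simp: algebra_simps)

lemma subdiv_diff: "subdiv p (\<lambda>i. x i - y i) K = subdiv p x K - subdiv p y K"
  using subdiv_add[of p "\<lambda>i. x i - y i" y K] by simp

lemma subdiv_scaleR_left: "subdiv p (\<lambda>i. x i *\<^sub>R w) K = subdiv p x K *\<^sub>R w"
  by (induction p arbitrary: K) (auto simp: algebra_simps)

lemma subdiv_cmult: "subdiv p (\<lambda>i. c * x i) K = c * subdiv p x K" for c :: real
  by (induction p arbitrary: K) (auto simp: algebra_simps)

lemma subdiv_const [simp]: "subdiv p (\<lambda>i. c) K = c"
  by (induction p arbitrary: K) (auto simp flip: scaleR_left.add simp: scaleR_2[symmetric])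

text \<open>\<open>subdiv p x K\<close> is a convex combination of the values at the indices from
  \<open>K div 2\<close> to \<open>(K + int p) div 2\<close>. Restricting the hypothesis to this
  stencil is what makes all later estimates local.\<close>

lemma norm_subdiv_le:
  fixes x :: "int \<Rightarrow> 'a::real_normed_vector"
  assumes "\<And>i. K div 2 \<le> i \<Longrightarrow> i \<le> (K + int p) div 2 \<Longrightarrow> norm (x i) \<le> B"
  shows "norm (subdiv p x K) \<le> B"
  using assms
proof (induction p arbitrary: K)
  case (Suc p)
  have "norm (subdiv p x K) \<le> B" "norm (subdiv p x (K + 1)) \<le> B"
    by (rule Suc.IH; rule Suc.prems; simp; linarith)+
  then have "norm (subdiv p x K + subdiv p x (K + 1)) \<le> B + B"
    by (intro norm_triangle_le) linarith
  then show ?case by simp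
qed auto

text \<open>Differencing prolongs the stencil of \<open>S_{p-2}\<close> by one index, and
  \<open>(K + p - 2) div 2 + 1 = (K + p) div 2\<close>. So this operator sees the same stencil as
  \<open>S_p\<close>, and one hypothesis serves both.\<close>

lemma norm_subdiv_fdiff_le:
  fixes x :: "int \<Rightarrow> 'a::real_normed_vector"
  assumes "2 \<le> p" "\<And>i. K div 2 \<le> i \<Longrightarrow> i \<le> (K + int p) div 2 \<Longrightarrow> norm (x i) \<le> B"
  shows "norm (subdiv (p - 2) (fdiff x) K) \<le> 2 * B"
proof (rule norm_subdiv_le)
  fix i assume i: "K div 2 \<le> i" "i \<le> (K + int (p - 2)) div 2"
  then have "norm (x i) \<le> B" "norm (x (i + 1)) \<le> B"
    using assms(1) by (auto intro!: assms(2) simp: of_nat_diff)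
  then show "norm (fdiff x i) \<le> 2 * B"
    unfolding fdiff_def using norm_triangle_ineq4[of "x (i + 1)" "x i"] by linarith
qed

text \<open>With \<open>y = subdiv 0 x\<close>, the difference of one average telescopes to half of
  \<open>y (K + 2) - y K\<close>, and a shift by two in the doubled sequence is a shift by one in
  \<open>x\<close>. Further averages commute with \<open>fdiff\<close>.\<close>

lemma fdiff_subdiv_Suc: "fdiff (subdiv (Suc p) x) K = (1/2) *\<^sub>R subdiv p (fdiff x) K"
proof (induction p arbitrary: K)
  case 0
  have "(K + 1 + 1) div 2 = K div 2 + 1" by simp
  then show ?case by (simp add: fdiff_def algebra_simps)
next
  case (Suc p)
  have "fdiff (subdiv (Suc (Suc p)) x) K
     = (1/2) *\<^sub>R (fdiff (subdiv (Suc p) x) K + fdiff (subdiv (Suc p) x) (K + 1))"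
    by (simp add: fdiff_def algebra_simps)
  then show ?case using Suc.IH by (simp add: algebra_simps)
qed

section \<open>Higher differences of sequences and of their refinements\<close>

lemma fdiff_const [simp]: "fdiff (\<lambda>i. c) = (\<lambda>i. 0)"
  by (auto simp: fdiff_def)

lemma fdiff_add: "fdiff (\<lambda>i. x i + y i) = (\<lambda>i. fdiff x i + fdiff y i)"
  by (auto simp: fdiff_def)

lemma fdiff_diff: "fdiff (\<lambda>i. x i - y i) = (\<lambda>i. fdiff x i - fdiff y i)"
  by (auto simp: fdiff_def)

lemma fdiff_scaleR_left: "fdiff (\<lambda>i. x i *\<^sub>R w) = (\<lambda>i. fdiff x i *\<^sub>R w)" for w :: "'a::real_vector"
  by (rule ext) (simp add: fdiff_def scaleR_left.diff)

lemma fdiff_scaleR_right: "fdiff (\<lambda>i. c *\<^sub>R x i) = (\<lambda>i. c *\<^sub>R fdiff x i)" for x :: "int \<Rightarrow> 'a::real_vector"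
  by (rule ext) (simp add: fdiff_def scaleR_right.diff)

lemma funpow_fdiff_subdiv:
  "(fdiff ^^ k) (subdiv (q + k) x) K = (1 / 2 ^ k) *\<^sub>R subdiv q ((fdiff ^^ k) x) K"
proof (induction k arbitrary: x K)
  case (Suc k)
  have "fdiff (subdiv (q + Suc k) x) = (\<lambda>i. (1/2) *\<^sub>R subdiv (q + k) (fdiff x) i)"
    using fdiff_subdiv_Suc by (auto simp del: subdiv.simps)
  moreover have "(fdiff ^^ k) (\<lambda>i. c *\<^sub>R y i) = (\<lambda>i. c *\<^sub>R (fdiff ^^ k) y i)" for c and y :: "int \<Rightarrow> 'a"
    by (induction k) (auto simp: fdiff_scaleR_right)
  ultimately show ?case
    using Suc.IH[of "fdiff x"] by (simp add: funpow_Suc_right del: funpow.simps)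
qed simp

lemma funpow_fdiff_diff:
  "(fdiff ^^ k) (\<lambda>i. x i - y i) = (\<lambda>i. (fdiff ^^ k) x i - (fdiff ^^ k) y i)"
  by (induction k) (auto simp: fdiff_diff)

lemma abs_funpow_fdiff_le:
  fixes x :: "int \<Rightarrow> real"
  assumes "\<And>i. \<bar>x i\<bar> \<le> B"
  shows "\<bar>(fdiff ^^ k) x i\<bar> \<le> 2 ^ k * B"
proof (induction k arbitrary: i)
  case (Suc k)
  show ?case using Suc.IH[of i] Suc.IH[of "i + 1"] by (simp add: fdiff_def)
qed (use assms in auto)

text \<open>All weights of \<open>S_q\<close> on its stencil are at least \<open>1 / 2 ^ q\<close>,
  and the increments of a monotone sequence are nonnegative. In the induction the spans belonging to
  \<open>K\<close> and \<open>K + 1\<close> overlap, so together they cover the larger span. This is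
  the lower bound that later allows division by \<open>S_{p-2} Delta x\<close>.\<close>

lemma span_le_subdiv_fdiff:
  fixes x :: "int \<Rightarrow> real"
  assumes "mono x"
  shows "x ((K + int q + 2) div 2) - x (K div 2) \<le> 2 ^ q * subdiv q (fdiff x) K"
proof (induction q arbitrary: K)
  case (Suc q)
  have "x ((K + 1) div 2) \<le> x ((K + int q + 2) div 2)"
    by (intro monoD[OF assms]) linarith
  then show ?case using Suc.IH[of K] Suc.IH[of "K + 1"] by (simp add: algebra_simps)
qed (simp add: fdiff_def)

lemma abs_subdiv_minus_le:
  fixes x :: "int \<Rightarrow> real"
  assumes "\<And>i. \<bar>fdiff x i\<bar> \<le> D"
  shows "\<bar>subdiv q x K - x (K div 2)\<bar> \<le> real q * D"
proof (induction q arbitrary: K)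
  case (Suc q)
  have "D \<ge> 0" using assms[of 0] by linarith
  have "\<bar>x ((K + 1) div 2) - x (K div 2)\<bar> \<le> D"
  proof (cases "(K + 1) div 2 = K div 2")
    case False
    then have "(K + 1) div 2 = K div 2 + 1" by linarith
    then show ?thesis using assms[of "K div 2"] by (simp add: fdiff_def)
  qed (use \<open>D \<ge> 0\<close> in simp)
  moreover have "\<bar>(a + b) / 2 - c\<bar> \<le> E + D"
    if "\<bar>y - c\<bar> \<le> D" "\<bar>a - c\<bar> \<le> E" "\<bar>b - y\<bar> \<le> E" for a b c y E :: real
    using that \<open>D \<ge> 0\<close> unfolding abs_le_iff by (simp add: field_simps)
  ultimately have "\<bar>(subdiv q x K + subdiv q x (K + 1)) / 2 - x (K div 2)\<bar> \<le> real q * D + D"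
    using Suc.IH[of K] Suc.IH[of "K + 1"] by blast
  then show ?case by (simp add: algebra_simps add_divide_distrib)
qed simp

lemma abs_diff_le_of_fdiff:
  fixes x :: "int \<Rightarrow> real"
  assumes "\<And>i. i0 \<le> i \<Longrightarrow> i < i0 + int n \<Longrightarrow> \<bar>fdiff x i - c\<bar> \<le> e"
  shows "\<bar>x (i0 + int n) - x i0 - real n * c\<bar> \<le> real n * e"
  using assms
proof (induction n)
  case (Suc n)
  have "\<bar>x (i0 + int n) - x i0 - real n * c\<bar> \<le> real n * e"
    using Suc by auto
  moreover have "\<bar>fdiff x (i0 + int n) - c\<bar> \<le> e" using Suc.prems by auto
  moreover have "x (i0 + int (Suc n)) - x i0 - real (Suc n) * c
      = (x (i0 + int n) - x i0 - real n * c) + (fdiff x (i0 + int n) - c)"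
    by (simp add: fdiff_def algebra_simps)
  ultimately have "\<bar>x (i0 + int (Suc n)) - x i0 - real (Suc n) * c\<bar> \<le> real n * e + e"
    by (simp add: abs_le_iff)
  then show ?case by (simp add: algebra_simps)
qed simp

section \<open>Moments of the subdivision weights\<close>

lemma subdiv_affine:
  "subdiv (Suc q) (\<lambda>i. real_of_int i - a) K = real_of_int K / 2 + real q / 4 - a"
proof (induction q arbitrary: K)
  case 0
  have "K div 2 + (K + 1) div 2 = K" by presburger
  then have "real_of_int (K div 2) + real_of_int ((K + 1) div 2) = real_of_int K"
    by (metis of_int_add)
  then show ?case by (simp add: algebra_simps)
next
  case (Suc q)
  show ?case unfolding subdiv.simps(2)[of "Suc q"] Suc.IH by (simp add: field_simps)
qed

text \<open>Read the weights of \<open>S_p\<close>, \<open>p = q + 3\<close>, as a probability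
  distribution: its mean is \<open>K / 2 + (p - 1) / 4\<close>, its variance
  \<open>(p + 1) / 16\<close>, its third central moment zero. Three averages are needed to start:
  for \<open>S_2\<close> the third central moment is nonzero with a sign depending on the parity of
  \<open>K\<close>. Each further average mixes two copies whose centres lie 1/2 apart and adds 1/16
  to the variance.\<close>

lemma subdiv_cubic:
  fixes a :: real
  shows "subdiv (q + 3) (\<lambda>i. (real_of_int i - a) ^ 3) K
     = (real_of_int K / 2 + (real q + 2) / 4 - a) ^ 3
       + 3 * (real q + 4) / 16 * (real_of_int K / 2 + (real q + 2) / 4 - a)"
proof (induction q arbitrary: K)
  case 0
  define f where "f i = (real_of_int i - a) ^ 3" for i :: int
  have 3: "subdiv 3 f K
     = (f (K div 2) + 3 * f ((K + 1) div 2) + 3 * f ((K + 2) div 2) + f ((K + 3) div 2)) / 8"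
    by (simp only: numeral_3_eq_3 subdiv.simps add.assoc) (simp add: field_simps)
  show ?case
  proof (cases "even K")
    case True
    then obtain m where m: "K = 2 * m" by (elim evenE)
    have "K div 2 = m" "(K + 1) div 2 = m" "(K + 2) div 2 = m + 1" "(K + 3) div 2 = m + 1"
      using m by presburger+
    then show ?thesis
      using 3 unfolding f_def m by (simp add: field_simps power3_eq_cube)
  next
    case False
    then obtain m where m: "K = 2 * m + 1" by (elim oddE)
    have "K div 2 = m" "(K + 1) div 2 = m + 1" "(K + 2) div 2 = m + 1" "(K + 3) div 2 = m + 2"
      using m by presburger+
    then show ?thesis
      using 3 unfolding f_def m by (simp add: field_simps power3_eq_cube)
  qed
next
  case (Suc q)
  show ?case unfolding add_Suc subdiv.simps(2)[of "q + 3"] Suc.IH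
    by (simp add: field_simps power3_eq_cube)
qed

section \<open>One step of the transform on a unit speed curve\<close>

text \<open>One integration of a power bound, by the mean value inequality. The factor
  \<open>1 / (n + 1)\<close> is given away, so that iterating from the highest derivative downwards
  yields Taylor bounds with the same constant \<open>C\<close> at each stage.\<close>

lemma norm_le_of_vderiv_le:
  fixes f :: "real \<Rightarrow> 'a::real_normed_vector"
  assumes der: "\<And>t. (f has_vector_derivative f' t) (at t)" and "f a = 0"
    and bound: "\<And>t. norm (f' t) \<le> C * \<bar>t - a\<bar> ^ n"
  shows "norm (f x) \<le> C * \<bar>x - a\<bar> ^ Suc n"
proof -
  have "C \<ge> 0"
    using order_trans[OF norm_ge_zero bound[of "a + 1"]] by simp
  have "norm (f x - f a) \<le> (C * \<bar>x - a\<bar> ^ n) * norm (x - a)"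
  proof (rule differentiable_bound)
    show "convex (closed_segment a x)" by simp
    fix t assume t: "t \<in> closed_segment a x"
    show "(f has_derivative (\<lambda>h. h *\<^sub>R f' t)) (at t within closed_segment a x)"
      using der[of t] unfolding has_vector_derivative_def by (rule has_derivative_at_withinI)
    have "\<bar>t - a\<bar> \<le> \<bar>x - a\<bar>"
      using t by (auto simp: closed_segment_eq_real_ivl split: if_splits)
    then have "norm (f' t) \<le> C * \<bar>x - a\<bar> ^ n"
      using bound[of t] \<open>C \<ge> 0\<close> by (meson abs_ge_zero mult_left_mono order_trans power_mono)
    then show "onorm (\<lambda>h. h *\<^sub>R f' t) \<le> C * \<bar>x - a\<bar> ^ n"
      by (intro onorm_le) (simp add: mult.commute mult_left_mono)
  qed auto
  then show ?thesis using \<open>f a = 0\<close> by (simp add: mult_ac)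
qed

text \<open>One constant bounds all derivatives. With \<open>1 \<le> M\<close> it also bounds
  \<open>v1\<close>, and lower powers of \<open>M\<close> can be absorbed into
  \<open>M\<^sup>2\<close>.\<close>

locale unit_speed_curve =
  fixes v v1 v2 v3 v4 :: "real \<Rightarrow> 'a::real_inner" and M :: real
  assumes deriv_v: "\<And>t. (v has_vector_derivative v1 t) (at t)"
    and deriv_v1: "\<And>t. (v1 has_vector_derivative v2 t) (at t)"
    and deriv_v2: "\<And>t. (v2 has_vector_derivative v3 t) (at t)"
    and deriv_v3: "\<And>t. (v3 has_vector_derivative v4 t) (at t)"
    and norm_v1: "\<And>t. norm (v1 t) = 1"
    and norm_v2: "\<And>t. norm (v2 t) \<le> M"
    and norm_v3: "\<And>t. norm (v3 t) \<le> M"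
    and norm_v4: "\<And>t. norm (v4 t) \<le> M"
    and M_ge_1: "1 \<le> M"
begin

section \<open>Tangent identities and Taylor bounds for a unit speed curve\<close>

lemma inner_v1_v1: "v1 t \<bullet> v1 t = 1"
  using norm_v1[of t] by (simp add: norm_eq_1)

lemma inner_v1_v2: "v1 t \<bullet> v2 t = 0"
proof -
  have "((\<lambda>t. v1 t \<bullet> v1 t) has_vector_derivative (v1 t \<bullet> v2 t + v2 t \<bullet> v1 t)) (at t)"
    by (intro bounded_bilinear.has_vector_derivative[OF bounded_bilinear_inner] deriv_v1)
  moreover have "((\<lambda>t. v1 t \<bullet> v1 t) has_vector_derivative 0) (at t)"
    by (simp add: inner_v1_v1)
  ultimately show ?thesis
    using vector_derivative_unique_at by (fastforce simp: inner_commute)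
qed

lemma lipschitz_v: "norm (v x - v y) \<le> \<bar>x - y\<bar>"
  using norm_le_of_vderiv_le[of "\<lambda>x. v x - v y" v1 y 1 0 x]
  by (simp add: norm_v1 deriv_v has_vector_derivative_diff_const)

lemma taylor_1: "norm (v x - v a - (x - a) *\<^sub>R v1 a) \<le> M * \<bar>x - a\<bar> ^ 2"
proof -
  have 1: "norm (v1 x - v1 a) \<le> M * \<bar>x - a\<bar> ^ Suc 0" for x
    by (rule norm_le_of_vderiv_le[where f' = v2])
      (auto simp: norm_v2 intro!: deriv_v1 derivative_eq_intros)
  show ?thesis
    unfolding numeral_2_eq_2
    by (rule norm_le_of_vderiv_le[where f' = "\<lambda>x. v1 x - v1 a"])
      (use 1 in \<open>auto intro!: deriv_v derivative_eq_intros\<close>)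
qed

lemma taylor_3:
  "norm (v x - v a - (x - a) *\<^sub>R v1 a - ((x - a)\<^sup>2 / 2) *\<^sub>R v2 a - ((x - a) ^ 3 / 6) *\<^sub>R v3 a)
     \<le> M * \<bar>x - a\<bar> ^ 4"
proof -
  have 1: "norm (v3 x - v3 a) \<le> M * \<bar>x - a\<bar> ^ Suc 0" for x
    by (rule norm_le_of_vderiv_le[where f' = v4])
      (auto simp: norm_v4 intro!: deriv_v3 derivative_eq_intros)
  have 2: "norm (v2 x - v2 a - (x - a) *\<^sub>R v3 a) \<le> M * \<bar>x - a\<bar> ^ Suc (Suc 0)" for x
    by (rule norm_le_of_vderiv_le[where f' = "\<lambda>x. v3 x - v3 a"])
      (use 1 in \<open>auto intro!: deriv_v2 derivative_eq_intros\<close>)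
  have 3: "norm (v1 x - v1 a - (x - a) *\<^sub>R v2 a - ((x - a)\<^sup>2 / 2) *\<^sub>R v3 a)
      \<le> M * \<bar>x - a\<bar> ^ Suc (Suc (Suc 0))" for x
    by (rule norm_le_of_vderiv_le[where f' = "\<lambda>x. v2 x - v2 a - (x - a) *\<^sub>R v3 a"])
      (use 2 in \<open>auto intro!: deriv_v1 derivative_eq_intros\<close>)
  have 4: "(4::nat) = Suc (Suc (Suc (Suc 0)))" by simp
  show ?thesis
    unfolding 4
    by (rule norm_le_of_vderiv_le
        [where f' = "\<lambda>x. v1 x - v1 a - (x - a) *\<^sub>R v2 a - ((x - a)\<^sup>2 / 2) *\<^sub>R v3 a"])
      (use 3 in \<open>auto intro!: deriv_v derivative_eq_intros\<close>)
qed

text \<open>On a short arc \<open>T\<close> is nearly \<open>\<tau> *\<^sub>R v1 a\<close>, and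
  \<open>S_p v\<close> lies within \<open>H\<close> of \<open>v a\<close>. Orthogonality says that
  \<open>v t - v a\<close> and \<open>S_p v - v a\<close> have the same component along
  \<open>T\<close>, so \<open>(t - a) * \<tau>\<close> is of size \<open>H * \<tau>\<close> up to
  errors that can be absorbed. The rough bound on \<open>t\<close> is needed first, to make the
  Taylor error of \<open>v t\<close> a small fraction of the distance from \<open>t\<close> to
  \<open>a\<close>.\<close>

lemma parameter_near_stencil:
  assumes "2 \<le> p" and "mono x"
    and orth: "(subdiv p (\<lambda>i. v (x i)) K - v t) \<bullet> subdiv (p - 2) (fdiff (\<lambda>i. v (x i))) K = 0"
    and nz: "subdiv (p - 2) (fdiff (\<lambda>i. v (x i))) K \<noteq> 0"
    and H: "H = x ((K + int p) div 2) - x (K div 2)" "H \<le> 1 / (2 ^ (p + 4) * M)"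
    and t: "\<bar>t - x (K div 2)\<bar> \<le> 1 / (2 ^ (p + 4) * M)"
  shows "\<bar>t - x (K div 2)\<bar> \<le> 2 * H"
proof -
  define a where "a = x (K div 2)"
  define T where "T = subdiv (p - 2) (fdiff (\<lambda>i. v (x i))) K"
  define \<tau> where "\<tau> = subdiv (p - 2) (fdiff x) K"
  define E where "E = T - \<tau> *\<^sub>R v1 a"
  define F where "F = v t - v a - (t - a) *\<^sub>R v1 a"
  have M: "0 < M" "1 \<le> M" using M_ge_1 by auto
  have in_range: "0 \<le> x i - a \<and> x i - a \<le> H" if "K div 2 \<le> i" "i \<le> (K + int p) div 2" for i
    using that monoD[OF \<open>mono x\<close>] unfolding a_def H by auto
  have "0 \<le> H" unfolding H by (simp add: monoD[OF \<open>mono x\<close>] zdiv_mono1)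
  have H_le: "H \<le> 2 ^ (p - 2) * \<tau>"
    using span_le_subdiv_fdiff[OF \<open>mono x\<close>, of K "p - 2"] \<open>2 \<le> p\<close>
    by (simp add: H \<tau>_def of_nat_diff)
  \<comment> \<open>The factor 64 in the smallness condition makes the tangent error
    \<open>E\<close> small relative to \<open>\<tau>\<close>; the factor \<open>2 ^ (p - 2)\<close>
    pays for passing from \<open>H\<close> to \<open>\<tau>\<close>.\<close>
  have pow: "(2::real) ^ (p + 4) = 2 ^ (p - 2) * 64"
  proof -
    obtain q where "p = q + 2" using \<open>2 \<le> p\<close> by (metis add.commute le_Suc_ex)
    then show ?thesis by (simp add: power_add)
  qed
  have E: "norm E \<le> 2 * (M * H\<^sup>2)"
  proof -
    have "E = subdiv (p - 2) (fdiff (\<lambda>i. v (x i) - v a - (x i - a) *\<^sub>R v1 a)) K"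
      unfolding E_def T_def \<tau>_def
      by (simp add: fdiff_diff fdiff_scaleR_left subdiv_diff subdiv_scaleR_left)
    moreover have "norm (v (x i) - v a - (x i - a) *\<^sub>R v1 a) \<le> M * H\<^sup>2"
      if "K div 2 \<le> i" "i \<le> (K + int p) div 2" for i
      using taylor_1[of "x i" a] in_range[OF that] M
      by (smt (verit) mult_left_mono power_mono)
    ultimately show ?thesis by (simp add: norm_subdiv_fdiff_le \<open>2 \<le> p\<close>)
  qed
  also have "\<dots> \<le> \<tau> / 8"
  proof -
    have "2 ^ (p - 2) * 64 * (M * H) \<le> 1" using H(2) M unfolding pow by (simp add: field_simps)
    then have "2 * (M * H\<^sup>2) * (2 ^ (p - 2) * 32) \<le> H"
      using mult_right_mono[of _ 1 H] \<open>0 \<le> H\<close> by (fastforce simp: power2_eq_square algebra_simps)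
    also note H_le
    finally have "2 ^ (p - 2) * (2 * (M * H\<^sup>2) * 32) \<le> 2 ^ (p - 2) * \<tau>" by (simp add: mult_ac)
    then have "2 * (M * H\<^sup>2) * 32 \<le> \<tau>" by simp
    moreover have "0 \<le> M * H\<^sup>2" using M by simp
    ultimately show ?thesis by linarith
  qed
  finally have E8: "norm E \<le> \<tau> / 8" .
  have T_eq: "T = \<tau> *\<^sub>R v1 a + E" by (simp add: E_def)
  have "0 \<le> 2 ^ (p - 2) * \<tau>" using H_le \<open>0 \<le> H\<close> by linarith
  then have "0 \<le> \<tau>"
    using mult_le_cancel_left_pos[of "2 ^ (p - 2)" 0 \<tau>] by simp
  have "\<tau> \<noteq> 0" using E8 T_eq nz T_def by auto
  then have "0 < \<tau>" using \<open>0 \<le> \<tau>\<close> by simp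
  have T_le: "norm T \<le> 9 / 8 * \<tau>"
    using E8 norm_triangle_ineq[of "\<tau> *\<^sub>R v1 a" E] \<open>0 \<le> \<tau>\<close> unfolding T_eq by (simp add: norm_v1)
  have F: "norm F \<le> \<bar>t - a\<bar> / 8"
  proof -
    have "norm F \<le> M * \<bar>t - a\<bar> * \<bar>t - a\<bar>"
      using taylor_1[of t a] by (simp add: F_def power2_eq_square)
    also have "M * \<bar>t - a\<bar> \<le> 1 / 8"
    proof -
      have "M * \<bar>t - a\<bar> \<le> M * (1 / (2 ^ (p + 4) * M))"
        using t M unfolding a_def by (intro mult_left_mono) auto
      also have "\<dots> = 1 / 2 ^ (p + 4)" using M by simp
      also have "\<dots> \<le> 1 / 2 ^ 3" by (intro divide_left_mono power_increasing) auto
      finally show ?thesis by simp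
    qed
    finally show ?thesis by (simp add: mult_right_mono)
  qed
  have S: "norm (subdiv p (\<lambda>i. v (x i)) K - v a) \<le> H"
  proof -
    have "norm (subdiv p (\<lambda>i. v (x i) - v a) K) \<le> H"
    proof (rule norm_subdiv_le)
      fix i assume "K div 2 \<le> i" "i \<le> (K + int p) div 2"
      from in_range[OF this] show "norm (v (x i) - v a) \<le> H"
        using lipschitz_v[of "x i" a] by linarith
    qed
    then show ?thesis by (simp add: subdiv_diff)
  qed
  \<comment> \<open>Expand \<open>(v t - v a) \<bullet> T\<close> with
    \<open>v t - v a = (t - a) *\<^sub>R v1 a + F\<close> and
    \<open>T = \<tau> *\<^sub>R v1 a + E\<close>; the leading product is
    \<open>(t - a) * \<tau>\<close> because \<open>v1 a\<close> is a unit vector.\<close>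
  have "(t - a) * \<tau> = (v t - v a) \<bullet> T - ((t - a) *\<^sub>R v1 a) \<bullet> E - F \<bullet> T"
    by (simp add: T_eq F_def inner_simps inner_v1_v1 algebra_simps)
  also have "(v t - v a) \<bullet> T = (subdiv p (\<lambda>i. v (x i)) K - v a) \<bullet> T"
    using orth by (simp add: T_def inner_diff_left)
  finally have "\<bar>t - a\<bar> * \<tau> \<le> \<bar>(subdiv p (\<lambda>i. v (x i)) K - v a) \<bullet> T\<bar>
      + \<bar>((t - a) *\<^sub>R v1 a) \<bullet> E\<bar> + \<bar>F \<bullet> T\<bar>"
    using \<open>0 \<le> \<tau>\<close> by (simp add: abs_mult[symmetric])
  also have "\<dots> \<le> H * (9 / 8 * \<tau>) + \<bar>t - a\<bar> * (\<tau> / 8) + \<bar>t - a\<bar> / 8 * (9 / 8 * \<tau>)"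
    by (intro add_mono order_trans[OF Cauchy_Schwarz_ineq2] mult_mono S T_le F E8)
      (use \<open>0 \<le> H\<close> in \<open>auto simp: norm_v1\<close>)
  \<comment> \<open>The error terms take \<open>1 / 8\<close> and \<open>9 / 64\<close> of the left
    side, which leaves \<open>47 / 64\<close>.\<close>
  finally have "(47 / 64 * \<bar>t - a\<bar>) * \<tau> \<le> (9 / 8 * H) * \<tau>" by (simp add: algebra_simps)
  then have "47 / 64 * \<bar>t - a\<bar> \<le> 9 / 8 * H" using \<open>0 < \<tau>\<close> by simp
  moreover have "u \<le> 2 * H" if "47 / 64 * u \<le> 9 / 8 * H" for u
    using that \<open>0 \<le> H\<close> by linarith
  ultimately have "\<bar>t - a\<bar> \<le> 2 * H" by blast
  then show ?thesis unfolding a_def .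
qed

text \<open>Expand both factors of the orthogonality relation at the new parameter \<open>t\<close>;
  \<open>A k\<close> and \<open>B k\<close> are the moments that appear. Since
  \<open>v1 t \<bullet> v2 t = 0\<close>, there are no terms of order three. Those of order four are
  \<open>A 1 * B 3\<close>, \<open>A 3 * B 1\<close> and \<open>A 2 * B 2\<close>; each contains one
  of \<open>A 1\<close>, \<open>A 3\<close>, \<open>B 2\<close>, which are kept in the bound because
  they become small for nearly affine \<open>x\<close>. Everything else is of order five.\<close>

lemma local_expansion:
  assumes "2 \<le> p" and "0 \<le> G" "G \<le> 1"
    and G: "\<And>i. K div 2 \<le> i \<Longrightarrow> i \<le> (K + int p) div 2 \<Longrightarrow> \<bar>x i - t\<bar> \<le> G"
    and orth: "(subdiv p (\<lambda>i. v (x i)) K - v t) \<bullet> subdiv (p - 2) (fdiff (\<lambda>i. v (x i))) K = 0"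
  defines "A \<equiv> \<lambda>k. subdiv p (\<lambda>i. (x i - t) ^ k) K"
    and "B \<equiv> \<lambda>k. subdiv (p - 2) (fdiff (\<lambda>i. (x i - t) ^ k)) K"
  shows "\<bar>A 1 * B 1\<bar> \<le> 7 * M\<^sup>2 * (\<bar>A 1\<bar> * G ^ 3 + \<bar>A 3\<bar> * G + G\<^sup>2 * \<bar>B 2\<bar> + G ^ 5)"
proof -
  define R where
    "R y = v y - v t - (y - t) *\<^sub>R v1 t - ((y - t)\<^sup>2 / 2) *\<^sub>R v2 t - ((y - t) ^ 3 / 6) *\<^sub>R v3 t" for y
  define T where "T = subdiv (p - 2) (fdiff (\<lambda>i. v (x i))) K"
  define RA where "RA = subdiv p (\<lambda>i. R (x i)) K"
  define RB where "RB = subdiv (p - 2) (fdiff (\<lambda>i. R (x i))) K"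
  define PA where "PA = A 1 *\<^sub>R v1 t + (A 2 / 2) *\<^sub>R v2 t + (A 3 / 6) *\<^sub>R v3 t"
  define PB where "PB = B 1 *\<^sub>R v1 t + (B 2 / 2) *\<^sub>R v2 t + (B 3 / 6) *\<^sub>R v3 t"
  have M: "0 < M" "1 \<le> M" using M_ge_1 by auto
  have A_le: "\<bar>A k\<bar> \<le> G ^ k" for k
    unfolding A_def real_norm_def[symmetric]
    by (rule norm_subdiv_le) (simp add: power_abs power_mono G)
  have B_le: "\<bar>B k\<bar> \<le> 2 * G ^ k" for k
    unfolding B_def real_norm_def[symmetric]
    by (rule norm_subdiv_fdiff_le[OF \<open>2 \<le> p\<close>])
      (simp add: power_abs power_mono G)
  have R_le: "norm (R (x i)) \<le> M * G ^ 4" if "K div 2 \<le> i" "i \<le> (K + int p) div 2" for i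
    using taylor_3[of "x i" t] G[OF that] M unfolding R_def
    by (meson abs_ge_zero less_imp_le mult_left_mono order_trans power_mono)
  have RA_le: "norm RA \<le> M * G ^ 4" unfolding RA_def by (rule norm_subdiv_le) (rule R_le)
  have RB_le: "norm RB \<le> 2 * (M * G ^ 4)"
    unfolding RB_def by (rule norm_subdiv_fdiff_le[OF \<open>2 \<le> p\<close>]) (rule R_le)
  have v_eq: "(\<lambda>i. v (x i)) = (\<lambda>i. v t + ((x i - t) ^ 1 *\<^sub>R v1 t
      + (x i - t)\<^sup>2 *\<^sub>R ((1 / 2) *\<^sub>R v2 t) + (x i - t) ^ 3 *\<^sub>R ((1 / 6) *\<^sub>R v3 t) + R (x i)))"
    by (rule ext) (simp add: R_def)
  have A_eq: "subdiv p (\<lambda>i. v (x i)) K - v t = PA + RA"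
    unfolding v_eq subdiv_add subdiv_scaleR_left subdiv_const PA_def RA_def A_def by simp
  have T_eq: "T = PB + RB"
    unfolding T_def v_eq fdiff_add fdiff_scaleR_left fdiff_const subdiv_add subdiv_scaleR_left
      subdiv_const PB_def RB_def B_def by simp
  have T_le: "norm T \<le> 2 * G"
  proof -
    have "T = subdiv (p - 2) (fdiff (\<lambda>i. v (x i) - v t)) K"
      by (simp add: T_def fdiff_diff)
    moreover have "norm (v (x i) - v t) \<le> G" if "K div 2 \<le> i" "i \<le> (K + int p) div 2" for i
      using lipschitz_v[of "x i" t] G[OF that] by linarith
    ultimately show ?thesis by (simp add: norm_subdiv_fdiff_le \<open>2 \<le> p\<close>)
  qed
  have A_vec: "norm (subdiv p (\<lambda>i. v (x i)) K - v t) \<le> G"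
  proof -
    have "norm (subdiv p (\<lambda>i. v (x i) - v t) K) \<le> G"
    proof (rule norm_subdiv_le)
      fix i assume "K div 2 \<le> i" "i \<le> (K + int p) div 2"
      from G[OF this] show "norm (v (x i) - v t) \<le> G"
        using lipschitz_v[of "x i" t] by linarith
    qed
    then show ?thesis by (simp add: subdiv_diff)
  qed
  have G4: "G ^ 4 \<le> G" using \<open>0 \<le> G\<close> \<open>G \<le> 1\<close> power_decreasing[of 1 4 G] by simp
  \<comment> \<open>\<open>PA\<close> is the full vector minus the remainder \<open>RA\<close>. The
    Lipschitz bound on the full vector gives a better constant than summing the three terms of
    \<open>PA\<close>.\<close>
  have PA_le: "norm PA \<le> 2 * M * G"
  proof -
    have "norm PA \<le> G + M * G ^ 4"
      using A_vec RA_le norm_triangle_ineq4[of "PA + RA" RA] unfolding A_eq by simp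
    also have "\<dots> \<le> M * G + M * G"
      using M G4 \<open>0 \<le> G\<close> mult_right_mono[of 1 M G] by (intro add_mono mult_left_mono) auto
    finally show ?thesis by (simp add: mult_ac)
  qed
  define a where "a = v1 t \<bullet> v3 t"
  define b where "b = v2 t \<bullet> v2 t"
  define c where "c = v2 t \<bullet> v3 t"
  define e where "e = v3 t \<bullet> v3 t"
  have abce: "\<bar>a\<bar> \<le> M\<^sup>2" "\<bar>b\<bar> \<le> M\<^sup>2" "\<bar>c\<bar> \<le> M\<^sup>2" "\<bar>e\<bar> \<le> M\<^sup>2"
  proof -
    have "\<bar>u \<bullet> w\<bar> \<le> M\<^sup>2" if "norm u \<le> M" "norm w \<le> M" for u w :: 'a
      unfolding power2_eq_square using M that
      by (intro order_trans[OF Cauchy_Schwarz_ineq2] mult_mono) auto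
    then show "\<bar>a\<bar> \<le> M\<^sup>2" "\<bar>b\<bar> \<le> M\<^sup>2" "\<bar>c\<bar> \<le> M\<^sup>2" "\<bar>e\<bar> \<le> M\<^sup>2"
      unfolding a_def b_def c_def e_def using norm_v1[of t] norm_v2[of t] norm_v3[of t] M(2) by metis+
  qed
  have "0 = (PA + RA) \<bullet> T" using orth by (simp add: A_eq T_def)
  also have "\<dots> = PA \<bullet> PB + PA \<bullet> RB + RA \<bullet> T" by (simp add: T_eq inner_simps)
  also have "PA \<bullet> PB = A 1 * B 1 + (A 1 * B 3 + A 3 * B 1) * a / 6 + A 2 * B 2 * b / 4
      + (A 2 * B 3 + A 3 * B 2) * c / 12 + A 3 * B 3 * e / 36"
    unfolding PA_def PB_def a_def b_def c_def e_def
    by (simp add: inner_simps inner_v1_v1 inner_v1_v2 inner_commute[of "v2 t" "v1 t"]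
        inner_commute[of "v3 t" "v1 t"] inner_commute[of "v3 t" "v2 t"] field_simps)
  finally have "A 1 * B 1 = - ((A 1 * B 3 + A 3 * B 1) * a / 6 + A 2 * B 2 * b / 4
      + (A 2 * B 3 + A 3 * B 2) * c / 12 + A 3 * B 3 * e / 36 + PA \<bullet> RB + RA \<bullet> T)"
    by linarith
  then have "\<bar>A 1 * B 1\<bar> \<le> \<bar>(A 1 * B 3 + A 3 * B 1) * a / 6\<bar> + \<bar>A 2 * B 2 * b / 4\<bar>
      + \<bar>(A 2 * B 3 + A 3 * B 2) * c / 12\<bar> + \<bar>A 3 * B 3 * e / 36\<bar> + \<bar>PA \<bullet> RB\<bar> + \<bar>RA \<bullet> T\<bar>"
    by linarith
  also have "\<dots> \<le> (\<bar>A 1\<bar> * (2 * G ^ 3) + \<bar>A 3\<bar> * (2 * G)) * M\<^sup>2 / 6 + G\<^sup>2 * \<bar>B 2\<bar> * M\<^sup>2 / 4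
      + (G\<^sup>2 * (2 * G ^ 3) + G ^ 3 * (2 * G\<^sup>2)) * M\<^sup>2 / 12 + G ^ 3 * (2 * G ^ 3) * M\<^sup>2 / 36
      + (2 * M * G) * (2 * (M * G ^ 4)) + (M * G ^ 4) * (2 * G)"
  proof (intro add_mono)
    show "\<bar>(A 1 * B 3 + A 3 * B 1) * a / 6\<bar> \<le> (\<bar>A 1\<bar> * (2 * G ^ 3) + \<bar>A 3\<bar> * (2 * G)) * M\<^sup>2 / 6"
      unfolding abs_mult abs_divide abs_numeral
      using B_le[of 1] B_le[of 3] abce \<open>0 \<le> G\<close>
      by (intro divide_right_mono mult_mono order_trans[OF abs_triangle_ineq] add_mono)
        (auto simp: abs_mult intro!: mult_mono)
    show "\<bar>A 2 * B 2 * b / 4\<bar> \<le> G\<^sup>2 * \<bar>B 2\<bar> * M\<^sup>2 / 4"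
      unfolding abs_mult abs_divide abs_numeral
      using A_le[of 2] abce \<open>0 \<le> G\<close> by (intro divide_right_mono mult_mono) auto
    show "\<bar>(A 2 * B 3 + A 3 * B 2) * c / 12\<bar> \<le> (G\<^sup>2 * (2 * G ^ 3) + G ^ 3 * (2 * G\<^sup>2)) * M\<^sup>2 / 12"
      unfolding abs_mult abs_divide abs_numeral
      using A_le[of 2] A_le[of 3] B_le[of 2] B_le[of 3] abce \<open>0 \<le> G\<close>
      by (intro divide_right_mono mult_mono order_trans[OF abs_triangle_ineq] add_mono)
        (auto simp: abs_mult intro!: mult_mono)
    show "\<bar>A 3 * B 3 * e / 36\<bar> \<le> G ^ 3 * (2 * G ^ 3) * M\<^sup>2 / 36"
      unfolding abs_mult abs_divide abs_numeral
      using A_le[of 3] B_le[of 3] abce \<open>0 \<le> G\<close> by (intro divide_right_mono mult_mono) auto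
    show "\<bar>PA \<bullet> RB\<bar> \<le> (2 * M * G) * (2 * (M * G ^ 4))"
      using PA_le RB_le \<open>0 \<le> G\<close> M by (intro order_trans[OF Cauchy_Schwarz_ineq2] mult_mono) auto
    show "\<bar>RA \<bullet> T\<bar> \<le> (M * G ^ 4) * (2 * G)"
      using RA_le T_le \<open>0 \<le> G\<close> M by (intro order_trans[OF Cauchy_Schwarz_ineq2] mult_mono) auto
  qed
  also have "\<dots> = M\<^sup>2 * (\<bar>A 1\<bar> * G ^ 3) / 3 + M\<^sup>2 * (\<bar>A 3\<bar> * G) / 3 + M\<^sup>2 * (G\<^sup>2 * \<bar>B 2\<bar>) / 4
      + M\<^sup>2 * G ^ 5 / 3 + M\<^sup>2 * G ^ 6 / 18 + 4 * (M\<^sup>2 * G ^ 5) + 2 * (M * G ^ 5)"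
    by (simp add: field_simps eval_nat_numeral)
  also have "\<dots> \<le> 7 * (M\<^sup>2 * (\<bar>A 1\<bar> * G ^ 3)) + 7 * (M\<^sup>2 * (\<bar>A 3\<bar> * G))
      + 7 * (M\<^sup>2 * (G\<^sup>2 * \<bar>B 2\<bar>)) + 7 * (M\<^sup>2 * G ^ 5)"
  proof -
    have "0 \<le> M\<^sup>2 * (\<bar>A 1\<bar> * G ^ 3)" "0 \<le> M\<^sup>2 * (\<bar>A 3\<bar> * G)" "0 \<le> M\<^sup>2 * (G\<^sup>2 * \<bar>B 2\<bar>)"
      "0 \<le> M\<^sup>2 * G ^ 5" using \<open>0 \<le> G\<close> by auto
    moreover have "M\<^sup>2 * G ^ 6 \<le> M\<^sup>2 * G ^ 5"
      using \<open>0 \<le> G\<close> \<open>G \<le> 1\<close> by (intro mult_left_mono power_decreasing) auto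
    moreover have "M * G ^ 5 \<le> M\<^sup>2 * G ^ 5"
      using \<open>0 \<le> G\<close> M self_le_power[of M 2] by (intro mult_right_mono) auto
    ultimately show ?thesis by linarith
  qed
  finally show ?thesis by (simp add: algebra_simps)
qed

text \<open>\<open>t\<close> lies within \<open>2 * H\<close> of the first node and the nodes span
  \<open>H\<close>, so the local expansion applies with radius \<open>3 * H\<close>. Its left side
  contains \<open>B 1 = S_{p-2} Delta x\<close>, which is at least \<open>H / 2 ^ p\<close>;
  dividing by it costs one power of \<open>H\<close> on the right.\<close>

lemma normal_step_expansion:
  assumes "2 \<le> p" and "strict_mono x"
    and orth: "(subdiv p (\<lambda>i. v (x i)) K - v t) \<bullet> subdiv (p - 2) (fdiff (\<lambda>i. v (x i))) K = 0"
    and nz: "subdiv (p - 2) (fdiff (\<lambda>i. v (x i))) K \<noteq> 0"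
    and H: "H = x ((K + int p) div 2) - x (K div 2)" "H \<le> 1 / (2 ^ (p + 4) * M)"
    and t: "\<bar>t - x (K div 2)\<bar> \<le> 1 / (2 ^ (p + 4) * M)"
  defines "A \<equiv> \<lambda>k. subdiv p (\<lambda>i. (x i - t) ^ k) K"
    and "B \<equiv> \<lambda>k. subdiv (p - 2) (fdiff (\<lambda>i. (x i - t) ^ k)) K"
  shows "0 < H" and "3 * H \<le> 1"
    and "\<And>i. K div 2 \<le> i \<Longrightarrow> i \<le> (K + int p) div 2 \<Longrightarrow> \<bar>x i - t\<bar> \<le> 3 * H"
    and "\<bar>A 1\<bar> \<le> 21 * 2 ^ p * M\<^sup>2 * (\<bar>A 1\<bar> * (3 * H)\<^sup>2 + \<bar>A 3\<bar> + 3 * H * \<bar>B 2\<bar> + (3 * H) ^ 4)"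
proof -
  have "mono x" using \<open>strict_mono x\<close> by (rule strict_mono_mono)
  have M: "0 < M" "1 \<le> M" using M_ge_1 by auto
  have near: "\<bar>t - x (K div 2)\<bar> \<le> 2 * H"
    using parameter_near_stencil[OF \<open>2 \<le> p\<close> \<open>mono x\<close> orth nz H t] .
  have "K div 2 < (K + int p) div 2" using \<open>2 \<le> p\<close> by linarith
  then show "0 < H" using \<open>strict_mono x\<close> H(1) by (simp add: strict_mono_less)
  have "H \<le> 1 / 2 ^ 4"
  proof -
    have "(2::real) ^ 4 * 1 \<le> 2 ^ (p + 4) * M" using M by (intro mult_mono power_increasing) auto
    then have "1 / (2 ^ (p + 4) * M) \<le> 1 / 2 ^ 4" using M by (intro divide_left_mono) auto
    then show ?thesis using H(2) by linarith
  qed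
  then show "3 * H \<le> 1" by simp
  show G: "\<bar>x i - t\<bar> \<le> 3 * H" if "K div 2 \<le> i" "i \<le> (K + int p) div 2" for i
  proof -
    have "x (K div 2) \<le> x i" "x i \<le> x ((K + int p) div 2)"
      using that by (auto intro: monoD[OF \<open>mono x\<close>])
    then have "\<bar>x i - x (K div 2)\<bar> \<le> H" unfolding H by simp
    then show ?thesis using near by (simp add: abs_le_iff)
  qed
  have exp: "\<bar>A 1 * B 1\<bar> \<le> 7 * M\<^sup>2 *
      (\<bar>A 1\<bar> * (3 * H) ^ 3 + \<bar>A 3\<bar> * (3 * H) + (3 * H)\<^sup>2 * \<bar>B 2\<bar> + (3 * H) ^ 5)"
    unfolding A_def B_def using \<open>0 < H\<close> \<open>3 * H \<le> 1\<close>
    by (intro local_expansion[OF \<open>2 \<le> p\<close> _ _ G orth]) auto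
  have B1: "B 1 = subdiv (p - 2) (fdiff x) K" by (simp add: B_def fdiff_diff)
  have H_le: "H \<le> 2 ^ (p - 2) * B 1"
    using span_le_subdiv_fdiff[OF \<open>mono x\<close>, of K "p - 2"] \<open>2 \<le> p\<close>
    unfolding H B1 by (simp add: of_nat_diff)
  have "0 < 2 ^ (p - 2) * B 1" using H_le \<open>0 < H\<close> by linarith
  then have "0 < B 1" by (simp add: zero_less_mult_iff)
  have H_le': "H \<le> 2 ^ p * B 1"
    using H_le \<open>0 < B 1\<close> by (meson diff_le_self less_imp_le mult_right_mono one_le_numeral order_trans power_increasing)
  define X where "X = \<bar>A 1\<bar> * (3 * H)\<^sup>2 + \<bar>A 3\<bar> + 3 * H * \<bar>B 2\<bar> + (3 * H) ^ 4"
  have "0 \<le> X" using \<open>0 < H\<close> by (simp add: X_def)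
  have "\<bar>A 1\<bar> * B 1 = \<bar>A 1 * B 1\<bar>" using \<open>0 < B 1\<close> by (simp add: abs_mult)
  also have "\<dots> \<le> 7 * M\<^sup>2 * (3 * H * X)"
    using exp by (simp add: X_def algebra_simps eval_nat_numeral)
  also have "\<dots> \<le> 7 * M\<^sup>2 * (3 * (2 ^ p * B 1) * X)"
    using H_le' \<open>0 \<le> X\<close> by (intro mult_left_mono mult_right_mono) auto
  also have "\<dots> = (21 * 2 ^ p * M\<^sup>2 * X) * B 1" by simp
  finally show "\<bar>A 1\<bar> \<le> 21 * 2 ^ p * M\<^sup>2 * X" using \<open>0 < B 1\<close> by simp
qed

text \<open>The 7 of the local expansion, times 3 from the radius \<open>3 * H\<close>, times
  \<open>2 ^ p\<close> from dividing by \<open>B 1\<close>.\<close>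

definition step_const :: "nat \<Rightarrow> real" where
  "step_const p = 21 * 2 ^ p * M\<^sup>2"

text \<open>The sum of the coefficients collected in the refined one-step estimate: one for the
  feedback of the first moment through the cubic bound, one for the second differences, and
  \<open>81 = 3 ^ 4\<close> for the remainder.\<close>

definition step_const' :: "nat \<Rightarrow> real" where
  "step_const' p = step_const p * (135 * step_const p * (9 + 3 * (real p)\<^sup>2 + 12 * real p)
     + 2 * (real p)\<^sup>2 * (3 * (real p)\<^sup>2 + 12 * real p) + 81)"

lemma step_const_nonneg: "0 \<le> step_const p"
  by (simp add: step_const_def)

lemma step_const'_nonneg: "0 \<le> step_const' p"
  unfolding step_const'_def by (intro mult_nonneg_nonneg add_nonneg_nonneg step_const_nonneg) auto

text \<open>The trivial moment bounds already give third order. The constant is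
  \<open>135 = 5 * 27\<close>: there are five copies of \<open>G ^ 3\<close> with
  \<open>G = 3 * H\<close>.\<close>

lemma normal_step_cubic:
  assumes "2 \<le> p" and "strict_mono x"
    and orth: "(subdiv p (\<lambda>i. v (x i)) K - v t) \<bullet> subdiv (p - 2) (fdiff (\<lambda>i. v (x i))) K = 0"
    and nz: "subdiv (p - 2) (fdiff (\<lambda>i. v (x i))) K \<noteq> 0"
    and H: "H = x ((K + int p) div 2) - x (K div 2)" "H \<le> 1 / (2 ^ (p + 4) * M)"
    and t: "\<bar>t - x (K div 2)\<bar> \<le> 1 / (2 ^ (p + 4) * M)"
  shows "\<bar>subdiv p x K - t\<bar> \<le> 135 * step_const p * H ^ 3"
proof -
  define A where "A k = subdiv p (\<lambda>i. (x i - t) ^ k) K" for k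
  define B where "B k = subdiv (p - 2) (fdiff (\<lambda>i. (x i - t) ^ k)) K" for k
  note step = normal_step_expansion[OF assms(1-7), folded A_def B_def]
  define G where "G = 3 * H"
  have G: "0 \<le> G" "G \<le> 1" and near: "\<And>i. K div 2 \<le> i \<Longrightarrow> i \<le> (K + int p) div 2 \<Longrightarrow> \<bar>x i - t\<bar> \<le> G"
    using step by (auto simp: G_def)
  have A_le: "\<bar>A k\<bar> \<le> G ^ k" for k
    unfolding A_def real_norm_def[symmetric]
    by (rule norm_subdiv_le) (simp add: power_abs power_mono near)
  have B_le: "\<bar>B 2\<bar> \<le> 2 * G ^ 2"
    unfolding B_def real_norm_def[symmetric]
    by (rule norm_subdiv_fdiff_le[OF \<open>2 \<le> p\<close>]) (use power_mono[OF near, of _ 2] in simp)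
  have A1: "A 1 = subdiv p x K - t" by (simp add: A_def subdiv_diff)
  have "\<bar>A 1\<bar> \<le> step_const p * (\<bar>A 1\<bar> * G\<^sup>2 + \<bar>A 3\<bar> + G * \<bar>B 2\<bar> + G ^ 4)"
    using step(4) unfolding step_const_def G_def .
  also have "\<dots> \<le> step_const p * (G ^ 1 * G\<^sup>2 + G ^ 3 + G * (2 * G\<^sup>2) + G ^ 3)"
    using G B_le A_le[of 1] A_le[of 3]
    by (intro mult_left_mono add_mono mult_right_mono power_decreasing step_const_nonneg) auto
  also have "\<dots> = 135 * step_const p * H ^ 3"
    by (simp add: G_def power2_eq_square power3_eq_cube)
  finally show ?thesis unfolding A1 .
qed

text \<open>Around the centre \<open>K / 2 + (p - 1) / 4\<close> the weights of \<open>S\<^sub>p\<close> have vanishing first and third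
  moments, so that only the deviation of \<open>x\<close> from an affine sequence contributes below order four.\<close>

lemma normal_step_refined:
  assumes "3 \<le> p" and "strict_mono x"
    and orth: "(subdiv p (\<lambda>i. v (x i)) K - v t) \<bullet> subdiv (p - 2) (fdiff (\<lambda>i. v (x i))) K = 0"
    and nz: "subdiv (p - 2) (fdiff (\<lambda>i. v (x i))) K \<noteq> 0"
    and H: "H = x ((K + int p) div 2) - x (K div 2)" "H \<le> 1 / (2 ^ (p + 4) * M)"
    and t: "\<bar>t - x (K div 2)\<bar> \<le> 1 / (2 ^ (p + 4) * M)"
    and a: "\<And>i. \<bar>fdiff (fdiff x) i\<bar> \<le> a"
  shows "\<bar>subdiv p x K - t\<bar> \<le> step_const' p * (H\<^sup>2 * a + H ^ 4)"
proof -
  have "2 \<le> p" using \<open>3 \<le> p\<close> by simp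
  define A where "A k = subdiv p (\<lambda>i. (x i - t) ^ k) K" for k
  define B where "B k = subdiv (p - 2) (fdiff (\<lambda>i. (x i - t) ^ k)) K" for k
  note step = normal_step_expansion[OF \<open>2 \<le> p\<close> assms(2-7), folded A_def B_def]
  have A1: "A 1 = subdiv p x K - t" by (simp add: A_def subdiv_diff)
  have "0 \<le> a" using a[of 0] by simp
  have "0 < H" by (rule step(1))
  define m where "m = K div 2"
  define n where "n = (K + int p) div 2"
  define \<eta> where "\<eta> = fdiff x m"
  define c where "c = real_of_int K / 2 + (real p - 1) / 4"
  \<comment> \<open>The affine comparison sequence has the slope of \<open>x\<close> at the left end
    of the stencil and vanishes at the centre of the weights. It has no constant term, so
    \<open>S_p l\<close> vanishes at \<open>K\<close> and \<open>S_p r\<close> equals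
    \<open>A 1\<close> there.\<close>
  define l where "l i = \<eta> * (real_of_int i - c)" for i
  define r where "r i = x i - t - l i" for i
  \<comment> \<open>The values of \<open>r\<close> differ from \<open>r m\<close> by at most
    \<open>(real p)\<^sup>2 * a\<close>, and their weighted mean is \<open>A 1\<close>. Hence
    \<open>r m\<close> is within \<open>(real p)\<^sup>2 * a\<close> of \<open>A 1\<close>, and
    every value of \<open>r\<close> is bounded by \<open>\<rho>\<close>.\<close>
  define \<rho> where "\<rho> = 2 * (real p)\<^sup>2 * a + \<bar>A 1\<bar>"
  have "0 \<le> \<rho>" using \<open>0 \<le> a\<close> by (simp add: \<rho>_def)
  have mn: "m + 1 \<le> n" "n \<le> m + int p" using \<open>3 \<le> p\<close> unfolding m_def n_def by linarith+
  have \<eta>: "0 \<le> \<eta>" "\<eta> \<le> H"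
  proof -
    have "x m \<le> x (m + 1)" "x (m + 1) \<le> x n"
      using \<open>strict_mono x\<close> mn by (auto simp: strict_mono_less_eq)
    then show "0 \<le> \<eta>" "\<eta> \<le> H" by (auto simp: \<eta>_def fdiff_def H m_def n_def)
  qed
  obtain q where q: "p = q + 3" using \<open>3 \<le> p\<close> by (metis add.commute le_Suc_ex)
  have "subdiv p (\<lambda>i. real_of_int i - c) K = 0"
    using subdiv_affine[of "p - 1" c K] \<open>3 \<le> p\<close> by (simp add: c_def of_nat_diff)
  then have S_l: "subdiv p l K = 0" using subdiv_cmult[of p \<eta> _ K] by (simp add: l_def[abs_def])
  have S_l3: "subdiv p (\<lambda>i. l i ^ 3) K = 0"
    unfolding l_def power_mult_distrib subdiv_cmult using subdiv_cubic[of q c K]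
    by (simp add: q c_def add_divide_distrib)
  \<comment> \<open>Differences of a square are affine, with zero at \<open>c - 1 / 2\<close>. This
    is exactly the centre \<open>K / 2 + (p - 3) / 4\<close> of the weights of
    \<open>S_{p-2}\<close>, the sense in which the two operators are aligned.\<close>
  have S_l2: "subdiv (p - 2) (fdiff (\<lambda>i. (l i)\<^sup>2)) K = 0"
  proof -
    have "fdiff (\<lambda>i. (l i)\<^sup>2) = (\<lambda>i. 2 * \<eta>\<^sup>2 * (real_of_int i - (c - 1 / 2)))"
      by (rule ext) (simp add: fdiff_def l_def power2_eq_square algebra_simps)
    then show ?thesis
      using subdiv_affine[of q "c - 1 / 2" K]
      by (simp only: subdiv_cmult) (simp add: q c_def add_divide_distrib)
  qed
  have near: "\<bar>x i - t\<bar> \<le> 3 * H" if "m \<le> i" "i \<le> n" for i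
    using step(3) that unfolding m_def n_def .
  have l_le: "\<bar>l i\<bar> \<le> real p * H" if "m \<le> i" "i \<le> n" for i
  proof -
    have "2 * m \<ge> K - 1" "2 * n \<le> K + int p" unfolding m_def n_def by linarith+
    then have "K - 1 \<le> 2 * i" "2 * i \<le> K + int p" using that by linarith+
    then have "real_of_int (K - 1) \<le> real_of_int (2 * i)" "real_of_int (2 * i) \<le> real_of_int (K + int p)"
      by (simp_all only: of_int_le_iff)
    then have "\<bar>real_of_int i - c\<bar> \<le> real p"
      unfolding c_def abs_le_iff using \<open>3 \<le> p\<close> by (simp add: field_simps)
    then have "\<bar>\<eta>\<bar> * \<bar>real_of_int i - c\<bar> \<le> H * real p"
      using \<eta> by (intro mult_mono) auto
    then show ?thesis by (simp add: l_def abs_mult mult.commute)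
  qed
  have r_diff: "\<bar>r i - r m\<bar> \<le> (real p)\<^sup>2 * a" if "m \<le> i" "i \<le> n" for i
  proof -
    have \<Delta>: "\<bar>fdiff x k - \<eta>\<bar> \<le> real p * a" if "m \<le> k" "k \<le> n" for k
    proof -
      have "\<bar>fdiff x (m + int (nat (k - m))) - fdiff x m - real (nat (k - m)) * 0\<bar>
          \<le> real (nat (k - m)) * a"
        by (rule abs_diff_le_of_fdiff) (use a in simp)
      also have "\<dots> \<le> real p * a"
        using that mn \<open>0 \<le> a\<close> by (intro mult_right_mono) auto
      finally show ?thesis using that by (simp add: \<eta>_def)
    qed
    have "\<bar>r (m + int (nat (i - m))) - r m - real (nat (i - m)) * 0\<bar>
        \<le> real (nat (i - m)) * (real p * a)"
    proof (rule abs_diff_le_of_fdiff)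
      fix k assume "m \<le> k" "k < m + int (nat (i - m))"
      then have "\<bar>fdiff x k - \<eta>\<bar> \<le> real p * a" using that by (intro \<Delta>) auto
      moreover have "fdiff r k = fdiff x k - \<eta>"
        by (simp add: fdiff_def r_def l_def algebra_simps)
      ultimately show "\<bar>fdiff r k - 0\<bar> \<le> real p * a" by simp
    qed
    also have "\<dots> \<le> real p * (real p * a)"
      using that mn \<open>0 \<le> a\<close> by (intro mult_right_mono) auto
    finally show ?thesis using that by (simp add: power2_eq_square)
  qed
  have r_le: "\<bar>r i\<bar> \<le> \<rho>" if "m \<le> i" "i \<le> n" for i
  proof -
    have "subdiv p r K = A 1"
      unfolding r_def[abs_def] subdiv_diff A1 S_l by simp
    then have "subdiv p (\<lambda>i. r i - r m) K = A 1 - r m" by (simp add: subdiv_diff)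
    moreover have "norm (subdiv p (\<lambda>i. r i - r m) K) \<le> (real p)\<^sup>2 * a"
      by (rule norm_subdiv_le) (use r_diff in \<open>simp add: m_def n_def\<close>)
    ultimately have "\<bar>A 1 - r m\<bar> \<le> (real p)\<^sup>2 * a" by simp
    then show ?thesis using r_diff[OF that] unfolding \<rho>_def by (simp add: abs_le_iff) linarith
  qed
  have P3: "3 \<le> real p" using \<open>3 \<le> p\<close> by simp
  have near': "\<bar>x i - t\<bar> \<le> real p * H" if "m \<le> i" "i \<le> n" for i
    using near[OF that] mult_right_mono[OF P3, of H] \<open>0 < H\<close> by linarith
  have A3: "\<bar>A 3\<bar> \<le> \<rho> * (3 * (real p * H)\<^sup>2)"
  proof -
    have "\<bar>(x i - t) ^ 3 - l i ^ 3\<bar> \<le> \<rho> * (3 * (real p * H)\<^sup>2)" if "m \<le> i" "i \<le> n" for i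
    proof -
      have "(x i - t) ^ 3 - l i ^ 3
          = r i * ((x i - t) * (x i - t) + (x i - t) * l i + l i * l i)"
        by (simp add: r_def power3_eq_cube algebra_simps)
      also have "\<bar>\<dots>\<bar> \<le> \<rho> * ((real p * H) * (real p * H) + (real p * H) * (real p * H)
          + (real p * H) * (real p * H))"
      proof -
        have prod: "\<bar>y * z\<bar> \<le> (real p * H) * (real p * H)"
          if "\<bar>y\<bar> \<le> real p * H" "\<bar>z\<bar> \<le> real p * H" for y z
          unfolding abs_mult using \<open>0 < H\<close> that by (intro mult_mono) auto
        then show ?thesis
          unfolding abs_mult[of "r i"] using \<open>0 < H\<close> \<open>0 \<le> \<rho>\<close>
          by (intro mult_mono r_le that order_trans[OF abs_triangle_ineq] add_mono prod near' l_le)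
            auto
      qed
      finally show ?thesis by (simp add: power2_eq_square mult_ac)
    qed
    then have "norm (subdiv p (\<lambda>i. (x i - t) ^ 3 - l i ^ 3) K) \<le> \<rho> * (3 * (real p * H)\<^sup>2)"
      by (intro norm_subdiv_le) (simp add: m_def n_def)
    then show ?thesis by (simp add: subdiv_diff S_l3 A_def)
  qed
  have B2: "\<bar>B 2\<bar> \<le> 2 * (\<rho> * (2 * (real p * H)))"
  proof -
    have "\<bar>(x i - t)\<^sup>2 - (l i)\<^sup>2\<bar> \<le> \<rho> * (2 * (real p * H))" if "m \<le> i" "i \<le> n" for i
    proof -
      have "(x i - t)\<^sup>2 - (l i)\<^sup>2 = r i * ((x i - t) + l i)"
        by (simp add: r_def power2_eq_square algebra_simps)
      also have "\<bar>\<dots>\<bar> \<le> \<rho> * (real p * H + real p * H)"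
        unfolding abs_mult using \<open>0 \<le> \<rho>\<close>
        by (intro mult_mono r_le that order_trans[OF abs_triangle_ineq] add_mono near' l_le) auto
      finally show ?thesis by (simp add: mult_ac)
    qed
    then have "norm (subdiv (p - 2) (fdiff (\<lambda>i. (x i - t)\<^sup>2 - (l i)\<^sup>2)) K) \<le> 2 * (\<rho> * (2 * (real p * H)))"
      by (intro norm_subdiv_fdiff_le \<open>2 \<le> p\<close>) (simp add: m_def n_def)
    then show ?thesis by (simp add: fdiff_diff subdiv_diff S_l2 B_def)
  qed
  \<comment> \<open>\<open>A 1\<close> reappears on the right, through \<open>\<rho>\<close> and
    through the expansion itself, but always multiplied by \<open>H\<^sup>2\<close>. The cubic bound
    makes these terms of order \<open>H ^ 5\<close>, below the target order.\<close>
  have cubic: "\<bar>A 1\<bar> \<le> 135 * step_const p * H ^ 3"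
    unfolding A1 by (rule normal_step_cubic[OF \<open>2 \<le> p\<close> assms(2-7)])
  have "\<bar>A 1\<bar> \<le> step_const p * (\<bar>A 1\<bar> * (3 * H)\<^sup>2 + \<bar>A 3\<bar> + 3 * H * \<bar>B 2\<bar> + (3 * H) ^ 4)"
    using step(4) unfolding step_const_def .
  also have "\<dots> \<le> step_const p * (\<bar>A 1\<bar> * (3 * H)\<^sup>2 + \<rho> * (3 * (real p * H)\<^sup>2)
      + 3 * H * (2 * (\<rho> * (2 * (real p * H)))) + (3 * H) ^ 4)"
    using \<open>0 < H\<close> A3 B2 by (intro mult_left_mono add_mono step_const_nonneg) auto
  also have "\<dots> = step_const p * (\<bar>A 1\<bar> * H\<^sup>2 * (9 + 3 * (real p)\<^sup>2 + 12 * real p)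
      + 2 * (real p)\<^sup>2 * (3 * (real p)\<^sup>2 + 12 * real p) * (H\<^sup>2 * a) + 81 * H ^ 4)"
    by (simp add: \<rho>_def power2_eq_square eval_nat_numeral algebra_simps)
  also have "\<dots> \<le> step_const p * (135 * step_const p * H ^ 4 * (9 + 3 * (real p)\<^sup>2 + 12 * real p)
      + 2 * (real p)\<^sup>2 * (3 * (real p)\<^sup>2 + 12 * real p) * (H\<^sup>2 * a) + 81 * H ^ 4)"
  proof -
    have "\<bar>A 1\<bar> * H\<^sup>2 \<le> 135 * step_const p * H ^ 3 * H\<^sup>2"
      by (intro mult_right_mono cubic) auto
    also have "\<dots> = 135 * step_const p * H ^ 5" by (simp add: eval_nat_numeral)
    also have "\<dots> \<le> 135 * step_const p * H ^ 4"
      using \<open>0 < H\<close> step(2) step_const_nonneg by (intro mult_left_mono power_decreasing) auto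
    finally show ?thesis by (intro mult_left_mono add_mono mult_right_mono step_const_nonneg) auto
  qed
  also have "\<dots> \<le> step_const' p * (H\<^sup>2 * a + H ^ 4)"
  proof -
    define c1 where "c1 = 135 * step_const p * (9 + 3 * (real p)\<^sup>2 + 12 * real p)"
    define c2 where "c2 = 2 * (real p)\<^sup>2 * (3 * (real p)\<^sup>2 + 12 * real p)"
    have "0 \<le> c1" "0 \<le> c2"
      unfolding c1_def c2_def by (intro mult_nonneg_nonneg add_nonneg_nonneg step_const_nonneg; simp)+
    moreover have "0 \<le> H\<^sup>2 * a" "0 \<le> H ^ 4" using \<open>0 \<le> a\<close> by auto
    ultimately have "0 \<le> c1 * (H\<^sup>2 * a)" "0 \<le> c2 * H ^ 4" "0 \<le> 81 * (H\<^sup>2 * a)" by auto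
    moreover have "(c1 + c2 + 81) * (H\<^sup>2 * a + H ^ 4) = c1 * H ^ 4 + c2 * (H\<^sup>2 * a) + 81 * H ^ 4
        + c1 * (H\<^sup>2 * a) + c2 * H ^ 4 + 81 * (H\<^sup>2 * a)"
      by (simp add: algebra_simps)
    ultimately have "c1 * H ^ 4 + c2 * (H\<^sup>2 * a) + 81 * H ^ 4 \<le> (c1 + c2 + 81) * (H\<^sup>2 * a + H ^ 4)"
      by linarith
    then have "step_const p * (c1 * H ^ 4 + c2 * (H\<^sup>2 * a) + 81 * H ^ 4)
        \<le> step_const p * ((c1 + c2 + 81) * (H\<^sup>2 * a + H ^ 4))"
      by (rule mult_left_mono) (rule step_const_nonneg)
    then show ?thesis unfolding c1_def c2_def step_const'_def by (simp add: mult_ac)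
  qed
  finally show ?thesis unfolding A1 .
qed

end

section \<open>Limits of perturbed subdivision on dyadic grids\<close>

text \<open>Bounding increments by differences of one null sequence \<open>w\<close> makes every
  tail telescope, so the distance to the limit is bounded by \<open>w j\<close> itself, uniformly in
  \<open>t\<close>.\<close>

lemma uniform_tail_limit:
  fixes g :: "nat \<Rightarrow> 'a \<Rightarrow> real"
  assumes step: "\<And>j t. j0 \<le> j \<Longrightarrow> \<bar>g (Suc j) t - g j t\<bar> \<le> w j - w (Suc j)" and w: "w \<longlonglongrightarrow> 0"
  obtains G where "\<And>j t. j0 \<le> j \<Longrightarrow> \<bar>g j t - G t\<bar> \<le> w j"
proof -
  have tail: "\<bar>g (j + k) t - g j t\<bar> \<le> w j - w (j + k)" if "j0 \<le> j" for j k t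
  proof (induction k)
    case (Suc k)
    then show ?case using step[of "j + k" t] that by (simp add: abs_le_iff)
  qed simp
  have "\<exists>l. \<forall>j\<ge>j0. \<bar>g j t - l\<bar> \<le> w j" for t
  proof -
    have "Cauchy (\<lambda>k. g (k + j0) t)"
    proof (rule metric_CauchyI)
      fix e :: real assume "0 < e"
      then obtain m where m: "\<And>k l. m \<le> k \<Longrightarrow> m \<le> l \<Longrightarrow> dist (w k) (w l) < e"
        using LIMSEQ_imp_Cauchy[OF w] unfolding Cauchy_def by blast
      have *: "dist (g (k + j0) t) (g (l + j0) t) < e" if "m \<le> l" "l \<le> k" for k l
      proof -
        have "\<bar>g (k + j0) t - g (l + j0) t\<bar> \<le> w (l + j0) - w (k + j0)"
          using tail[of "l + j0" "k - l" t] that by (simp add: add.commute add.left_commute)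
        moreover have "w (l + j0) - w (k + j0) < e"
          using m[of "l + j0" "k + j0"] that by (simp add: dist_real_def)
        ultimately show ?thesis by (simp add: dist_real_def)
      qed
      then have "dist (g (k + j0) t) (g (l + j0) t) < e" if "m \<le> k" "m \<le> l" for k l
        using that *[of l k] *[of k l] by (cases "k \<le> l") (auto simp: dist_commute)
      then show "\<exists>m. \<forall>k\<ge>m. \<forall>l\<ge>m. dist (g (k + j0) t) (g (l + j0) t) < e" by blast
    qed
    then obtain l where l: "(\<lambda>k. g (k + j0) t) \<longlonglongrightarrow> l"
      using Cauchy_convergent convergent_def by blast
    then have l': "(\<lambda>k. g k t) \<longlonglongrightarrow> l" by (rule LIMSEQ_offset)
    have "\<bar>g j t - l\<bar> \<le> w j" if "j0 \<le> j" for j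
    proof (rule LIMSEQ_le)
      show "(\<lambda>k. \<bar>g j t - g (k + j) t\<bar>) \<longlonglongrightarrow> \<bar>g j t - l\<bar>"
        using l' by (intro tendsto_intros LIMSEQ_ignore_initial_segment)
      show "(\<lambda>k. w j - w (k + j)) \<longlonglongrightarrow> w j"
        using tendsto_diff[OF tendsto_const LIMSEQ_ignore_initial_segment[OF w]] by simp
      show "\<exists>n. \<forall>k\<ge>n. \<bar>g j t - g (k + j) t\<bar> \<le> w j - w (k + j)"
        using tail[OF that] by (simp add: abs_minus_commute add.commute)
    qed
    then show ?thesis by blast
  qed
  then show ?thesis using that by metis
qed

text \<open>The cell of \<open>t\<close> at level \<open>j + 1\<close> has the cell of
  \<open>t\<close> at level \<open>j\<close> as its parent, and \<open>div 2\<close> is also the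
  leftmost stencil index used by \<open>S_q\<close>.\<close>

lemma floor_dyadic_div: "\<lfloor>2 ^ Suc j * t\<rfloor> div 2 = \<lfloor>2 ^ j * t\<rfloor>" for t :: real
proof -
  have "2 ^ Suc j * t / real_of_int 2 = 2 ^ j * t" by simp
  then show ?thesis using floor_divide_real_eq_div[of 2 "2 ^ Suc j * t"] by simp
qed

lemma linear_over_exponential:
  assumes "1 < b" shows "(\<lambda>j. (real j + 2) / b ^ j) \<longlonglongrightarrow> 0"
proof -
  have "(\<lambda>j. real j / b ^ j + 2 * (1 / b) ^ j) \<longlonglongrightarrow> 0 + 2 * 0"
    using assms by (intro tendsto_add tendsto_mult tendsto_const LIMSEQ_power_zero lim_n_over_pown) auto
  then show ?thesis by (simp add: add_divide_distrib power_divide)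
qed

text \<open>The factor \<open>real j + 1\<close> is there for the scaled third differences, whose
  own differences are controlled only up to linear growth in the level. The limit inherits it as a
  logarithmic loss in its modulus of continuity.\<close>

lemma dyadic_limit:
  fixes x :: "nat \<Rightarrow> int \<Rightarrow> real"
  assumes "0 \<le> B"
    and \<Delta>: "\<And>j i. j0 \<le> j \<Longrightarrow> \<bar>fdiff (x j) i\<bar> \<le> B * (real j + 1) / 2 ^ j"
    and step: "\<And>j K. j0 \<le> j \<Longrightarrow> \<bar>x (Suc j) K - subdiv q (x j) K\<bar> \<le> B / 2 ^ j"
  obtains G :: "real \<Rightarrow> real" and W where "\<And>j t. j0 \<le> j \<Longrightarrow> \<bar>x j \<lfloor>2 ^ j * t\<rfloor> - G t\<bar> \<le> W * (real j + 2) / 2 ^ j"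
    and "\<And>j t t'. j0 \<le> j \<Longrightarrow> \<bar>t - t'\<bar> \<le> 1 / 2 ^ j \<Longrightarrow> \<bar>G t - G t'\<bar> \<le> W * (real j + 2) / 2 ^ j"
proof -
  \<comment> \<open>Chosen so that \<open>w j - w (Suc j) = (q + 1) * B * (j + 1) / 2 ^ j\<close>,
    which is the bound on one increment; this is also why \<open>w\<close> carries
    \<open>j + 2\<close>.\<close>
  define C where "C = 2 * (real q + 1) * B"
  define w where "w j = C * (real j + 2) / 2 ^ j" for j
  have "0 \<le> C" using \<open>0 \<le> B\<close> by (simp add: C_def)
  have w: "w \<longlonglongrightarrow> 0"
    using tendsto_mult[OF tendsto_const linear_over_exponential[of 2], of C] by (simp add: w_def[abs_def])
  have step_w: "\<bar>x (Suc j) \<lfloor>2 ^ Suc j * t\<rfloor> - x j \<lfloor>2 ^ j * t\<rfloor>\<bar> \<le> w j - w (Suc j)" if "j0 \<le> j" for j and t :: real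
  proof -
    define K where "K = \<lfloor>2 ^ Suc j * t\<rfloor>"
    have "\<bar>x (Suc j) K - x j (K div 2)\<bar> \<le> B / 2 ^ j + real q * (B * (real j + 1) / 2 ^ j)"
      using step[OF that, of K] abs_subdiv_minus_le[of "x j", OF \<Delta>[OF that], of q K]
      by (simp add: abs_le_iff)
    also have "\<dots> \<le> B * (real j + 1) / 2 ^ j + real q * (B * (real j + 1) / 2 ^ j)"
      using mult_left_mono[of 1 "real j + 1" B] \<open>0 \<le> B\<close> by (simp add: divide_right_mono)
    also have "\<dots> = w j - w (Suc j)" by (simp add: w_def C_def field_simps)
    finally show ?thesis unfolding K_def floor_dyadic_div .
  qed
  obtain G :: "real \<Rightarrow> real" where G: "\<And>j t. j0 \<le> j \<Longrightarrow> \<bar>x j \<lfloor>2 ^ j * t\<rfloor> - G t\<bar> \<le> w j"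
    using uniform_tail_limit[where g = "\<lambda>j t. x j \<lfloor>2 ^ j * t\<rfloor>", OF step_w w] by blast
  define W where "W = 2 * C + B"
  show ?thesis
  proof
    fix j and t :: real assume j: "j0 \<le> j"
    have "w j \<le> W * (real j + 2) / 2 ^ j"
      using \<open>0 \<le> B\<close> \<open>0 \<le> C\<close> unfolding w_def W_def by (intro divide_right_mono mult_right_mono) auto
    then show "\<bar>x j \<lfloor>2 ^ j * t\<rfloor> - G t\<bar> \<le> W * (real j + 2) / 2 ^ j" using G[OF j, of t] by linarith
  next
    fix j and t t' :: real assume j: "j0 \<le> j" and tt: "\<bar>t - t'\<bar> \<le> 1 / 2 ^ j"
    have *: "\<bar>G t - G t'\<bar> \<le> W * (real j + 2) / 2 ^ j" if tt: "\<bar>t - t'\<bar> \<le> 1 / 2 ^ j" and "t \<le> t'" for t t'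
    proof -
      have "0 \<le> 2 ^ j * (t' - t)" "2 ^ j * (t' - t) \<le> 1" using that by (auto simp: field_simps)
      then have "\<lfloor>2 ^ j * t'\<rfloor> = \<lfloor>2 ^ j * t\<rfloor> \<or> \<lfloor>2 ^ j * t'\<rfloor> = \<lfloor>2 ^ j * t\<rfloor> + 1"
        unfolding right_diff_distrib by linarith
      then have "\<bar>x j \<lfloor>2 ^ j * t'\<rfloor> - x j \<lfloor>2 ^ j * t\<rfloor>\<bar> \<le> B * (real j + 1) / 2 ^ j"
        using \<Delta>[OF j, of "\<lfloor>2 ^ j * t\<rfloor>"] \<open>0 \<le> B\<close> by (auto simp: fdiff_def)
      also have "\<dots> \<le> B * (real j + 2) / 2 ^ j"
        using \<open>0 \<le> B\<close> by (intro divide_right_mono mult_left_mono) auto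
      finally have "\<bar>G t - G t'\<bar> \<le> w j + w j + B * (real j + 2) / 2 ^ j"
        using G[OF j, of t] G[OF j, of t'] by (simp add: abs_le_iff)
      also have "\<dots> = W * (real j + 2) / 2 ^ j" by (simp add: w_def W_def field_simps)
      finally show ?thesis .
    qed
    show "\<bar>G t - G t'\<bar> \<le> W * (real j + 2) / 2 ^ j"
      using *[of t t'] *[of t' t] tt by (cases "t \<le> t'") (auto simp: abs_minus_commute)
  qed
qed

text \<open>At distance \<open>2 ^ -j\<close> the quotient of the modulus by the power
  \<open>\<alpha>\<close> of the distance is \<open>W * (j + 2) / \<beta> ^ j\<close> with
  \<open>\<beta> = 2 powr (1 - \<alpha>)\<close>, which is bounded because
  \<open>\<beta> > 1\<close>. Distances above \<open>2 ^ -j0\<close> are covered by the bound on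
  \<open>G\<close>.\<close>

lemma holder_of_dyadic_modulus:
  fixes G :: "real \<Rightarrow> real"
  assumes mod: "\<And>j t t'. j0 \<le> j \<Longrightarrow> \<bar>t - t'\<bar> \<le> 1 / 2 ^ j \<Longrightarrow> \<bar>G t - G t'\<bar> \<le> W * (real j + 2) / 2 ^ j"
    and bound: "\<And>t. \<bar>G t\<bar> \<le> b" and \<alpha>: "0 < \<alpha>" "\<alpha> < 1"
  shows "holder_continuous \<alpha> G"
proof -
  define \<beta> :: real where "\<beta> = 2 powr (1 - \<alpha>)"
  have \<beta>: "1 < \<beta>" using \<alpha> by (simp add: \<beta>_def)
  have "Bseq (\<lambda>j. (real j + 2) / \<beta> ^ j)"
    using linear_over_exponential[OF \<beta>] convergentI convergent_imp_Bseq by blast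
  then obtain c where c: "0 < c" "\<And>j. \<bar>(real j + 2) / \<beta> ^ j\<bar> \<le> c"
    unfolding Bseq_def by auto
  have W: "0 \<le> W"
  proof -
    have "0 \<le> W * (real j0 + 2) / 2 ^ j0" using mod[of j0 0 0] by simp
    moreover have "W * (real j0 + 2) / 2 ^ j0 < 0" if "W < 0"
      using that by (intro divide_neg_pos mult_neg_pos) auto
    ultimately show ?thesis by linarith
  qed
  have "0 \<le> b" using bound[of 0] by linarith
  have pow2: "2 ^ j = \<beta> ^ j * (2 ^ j) powr \<alpha>" for j
  proof -
    have "\<beta> ^ j = 2 powr ((1 - \<alpha>) * real j)"
      using powr_realpow[of \<beta> j] \<beta> by (simp add: \<beta>_def powr_powr)
    moreover have "(2 ^ j) powr \<alpha> = 2 powr (real j * \<alpha>)"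
      using powr_realpow[of 2 j] powr_powr[of 2 "real j" \<alpha>] by simp
    moreover have "2 ^ j = 2 powr ((1 - \<alpha>) * real j + real j * \<alpha>)"
      using powr_realpow[of 2 j] by (simp add: algebra_simps)
    ultimately show ?thesis by (simp only: powr_add)
  qed
  define C where "C = 2 * b * (2 ^ j0) powr \<alpha> + W * c * 2 powr \<alpha>"
  have "\<bar>G t - G t'\<bar> \<le> C * \<bar>t - t'\<bar> powr \<alpha>" for t t'
  proof (cases "t = t'")
    case False
    define d where "d = \<bar>t - t'\<bar>"
    have "0 < d" using False by (simp add: d_def)
    show ?thesis
    proof (cases "d \<le> 1 / 2 ^ j0")
      case False
      then have "1 \<le> (2 ^ j0 * d) powr \<alpha>" using \<alpha> by (intro ge_one_powr_ge_zero) (auto simp: field_simps)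
      then have "2 * b * 1 \<le> 2 * b * (2 ^ j0 * d) powr \<alpha>" using \<open>0 \<le> b\<close> by (intro mult_left_mono) auto
      also have "\<dots> \<le> C * d powr \<alpha>"
        using \<open>0 < d\<close> W c(1) by (simp add: C_def powr_mult algebra_simps)
      finally show ?thesis
        using bound[of t] bound[of t'] unfolding d_def by (simp add: abs_le_iff)
    next
      case True
      \<comment> \<open>The first dyadic length below \<open>d\<close>. For its predecessor
        \<open>j = n - 1\<close> one has \<open>d \<le> 1 / 2 ^ j < 2 * d\<close>, and
        \<open>j0 \<le> j\<close> since \<open>d\<close> is at most
        \<open>1 / 2 ^ j0\<close>.\<close>
      define n where "n = (LEAST n. 1 / 2 ^ n < d)"
      have "\<exists>n. 1 / 2 ^ n < d"
        using real_arch_pow_inv[of d "1 / 2"] \<open>0 < d\<close> by (auto simp: power_divide)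
      then have n: "1 / 2 ^ n < d" unfolding n_def by (rule LeastI_ex)
      have n_least: "d \<le> 1 / 2 ^ k" if "k < n" for k
        using not_less_Least[of k "\<lambda>n. 1 / 2 ^ n < d"] that by (simp add: n_def)
      have "j0 < n"
      proof (rule ccontr)
        assume "\<not> j0 < n"
        then have "(1::real) / 2 ^ j0 \<le> 1 / 2 ^ n" by (intro divide_left_mono power_increasing) auto
        then show False using n True by linarith
      qed
      then obtain j where j: "n = Suc j" "j0 \<le> j" by (cases n) auto
      have "\<bar>G t - G t'\<bar> \<le> W * (real j + 2) / 2 ^ j"
        using mod[OF j(2)] n_least[of j] j d_def by auto
      also have "\<dots> = W * ((real j + 2) / \<beta> ^ j) * (1 / (2 ^ j) powr \<alpha>)"
        by (subst pow2) simp
      also have "\<dots> \<le> W * c * (2 * d) powr \<alpha>"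
      proof (intro mult_mono mult_nonneg_nonneg)
        show "(real j + 2) / \<beta> ^ j \<le> c" using c(2)[of j] by linarith
        have "(1 / 2 ^ j) powr \<alpha> \<le> (2 * d) powr \<alpha>"
          using n \<alpha> j by (intro powr_mono2) (auto simp: field_simps)
        then show "1 / (2 ^ j) powr \<alpha> \<le> (2 * d) powr \<alpha>" by (simp add: powr_divide)
      qed (use W c(1) \<beta> in auto)
      also have "\<dots> \<le> C * d powr \<alpha>"
        using \<open>0 < d\<close> \<open>0 \<le> b\<close> by (simp add: C_def powr_mult algebra_simps)
      finally show ?thesis unfolding d_def .
    qed
  qed simp
  then show ?thesis unfolding holder_continuous_def by auto
qed

lemma holder_imp_continuous:
  fixes G :: "real \<Rightarrow> 'a::real_normed_vector"
  assumes "holder_continuous \<alpha> G" "0 < \<alpha>"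
  shows "isCont G a"
proof -
  obtain B where B: "\<And>x y. norm (G x - G y) \<le> B * \<bar>x - y\<bar> powr \<alpha>"
    using assms unfolding holder_continuous_def by auto
  have "((\<lambda>x. B * \<bar>x - a\<bar> powr \<alpha>) \<longlongrightarrow> B * \<bar>a - a\<bar> powr \<alpha>) (at a)"
    using assms(2) by (intro tendsto_intros) auto
  then have "((\<lambda>x. B * \<bar>x - a\<bar> powr \<alpha>) \<longlongrightarrow> 0) (at a)" by simp
  then have "((\<lambda>x. G x - G a) \<longlongrightarrow> 0) (at a)"
    by (rule Lim_null_comparison[rotated]) (simp add: B)
  then show ?thesis unfolding isCont_def by (simp add: LIM_zero_iff)
qed

text \<open>A mean value inequality passed to the limit: between the cells of \<open>b\<close> and
  \<open>c\<close> every increment is within \<open>(e + w j) / 2 ^ j\<close> of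
  \<open>m / 2 ^ j\<close>, and the number of cells divided by \<open>2 ^ j\<close> tends to
  \<open>c - b\<close>.\<close>

lemma dyadic_limit_mean_value:
  fixes x :: "nat \<Rightarrow> int \<Rightarrow> real"
  assumes G: "\<And>t. (\<lambda>j. x j \<lfloor>2 ^ j * t\<rfloor>) \<longlonglongrightarrow> G t"
    and D: "\<And>j t. j0 \<le> j \<Longrightarrow> \<bar>2 ^ j * fdiff (x j) \<lfloor>2 ^ j * t\<rfloor> - D t\<bar> \<le> w j"
    and w: "w \<longlonglongrightarrow> 0"
    and "b \<le> c" and e: "\<And>t. b \<le> t \<Longrightarrow> t \<le> c \<Longrightarrow> \<bar>D t - m\<bar> \<le> e"
  shows "\<bar>G c - G b - (c - b) * m\<bar> \<le> (c - b) * e"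
proof -
  define n where "n j = nat (\<lfloor>2 ^ j * c\<rfloor> - \<lfloor>2 ^ j * b\<rfloor>)" for j :: nat
  have floor_le: "\<lfloor>2 ^ j * b\<rfloor> \<le> \<lfloor>2 ^ j * c\<rfloor>" for j :: nat
    using \<open>b \<le> c\<close> by (intro floor_mono) simp
  have sum: "\<bar>x j \<lfloor>2 ^ j * c\<rfloor> - x j \<lfloor>2 ^ j * b\<rfloor> - real (n j) / 2 ^ j * m\<bar> \<le> real (n j) / 2 ^ j * (e + w j)"
    if "j0 \<le> j" for j
  proof -
    have "\<bar>x j (\<lfloor>2 ^ j * b\<rfloor> + int (n j)) - x j \<lfloor>2 ^ j * b\<rfloor> - real (n j) * (m / 2 ^ j)\<bar>
        \<le> real (n j) * ((e + w j) / 2 ^ j)"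
    proof (rule abs_diff_le_of_fdiff)
      fix i assume i: "\<lfloor>2 ^ j * b\<rfloor> \<le> i" "i < \<lfloor>2 ^ j * b\<rfloor> + int (n j)"
      \<comment> \<open>The dyadic point of the first index may lie to the left of \<open>b\<close>,
        so \<open>b\<close> itself represents that cell; all other cells in question start inside
        the interval.\<close>
      obtain t where t: "b \<le> t" "t \<le> c" "\<lfloor>2 ^ j * t\<rfloor> = i"
      proof (cases "i = \<lfloor>2 ^ j * b\<rfloor>")
        case True
        then show ?thesis using that[of b] \<open>b \<le> c\<close> by simp
      next
        case False
        have "i < \<lfloor>2 ^ j * c\<rfloor>" using i floor_le[of j] by (simp add: n_def)
        then have "real_of_int i \<le> 2 ^ j * c" by (simp add: less_floor_iff)
        moreover have "2 ^ j * b \<le> real_of_int i" using i False by linarith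
        ultimately show ?thesis using that[of "real_of_int i / 2 ^ j"] by (simp add: field_simps)
      qed
      have "\<bar>2 ^ j * fdiff (x j) i - m\<bar> \<le> e + w j"
        using D[OF \<open>j0 \<le> j\<close>, of t] e[OF t(1,2)] t(3) by (simp add: abs_le_iff)
      moreover have "2 ^ j * fdiff (x j) i - m = 2 ^ j * (fdiff (x j) i - m / 2 ^ j)"
        by (simp add: algebra_simps)
      ultimately show "\<bar>fdiff (x j) i - m / 2 ^ j\<bar> \<le> (e + w j) / 2 ^ j"
        by (simp add: abs_mult field_simps)
    qed
    then show ?thesis using floor_le[of j] by (simp add: n_def)
  qed
  have floor_lim: "(\<lambda>j. real_of_int \<lfloor>2 ^ j * t\<rfloor> / 2 ^ j) \<longlonglongrightarrow> t" for t :: real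
  proof (rule LIMSEQ_I)
    fix r :: real assume "0 < r"
    then obtain n where n: "(1 / 2) ^ n < r" using real_arch_pow_inv[of r "1 / 2"] by auto
    have "norm (real_of_int \<lfloor>2 ^ j * t\<rfloor> / 2 ^ j - t) < r" if "n \<le> j" for j
    proof -
      have "\<bar>real_of_int \<lfloor>2 ^ j * t\<rfloor> - 2 ^ j * t\<bar> \<le> 1" by linarith
      then have "\<bar>real_of_int \<lfloor>2 ^ j * t\<rfloor> - 2 ^ j * t\<bar> / 2 ^ j \<le> 1 / 2 ^ j"
        by (intro divide_right_mono) auto
      moreover have "real_of_int \<lfloor>2 ^ j * t\<rfloor> / 2 ^ j - t = (real_of_int \<lfloor>2 ^ j * t\<rfloor> - 2 ^ j * t) / 2 ^ j"
        by (simp add: field_simps)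
      moreover have "1 / 2 ^ j \<le> (1 / 2 :: real) ^ n"
        using that power_decreasing[of n j "1 / 2 :: real"] by (simp add: power_divide)
      ultimately show ?thesis using n by (simp add: abs_divide)
    qed
    then show "\<exists>n. \<forall>j\<ge>n. norm (real_of_int \<lfloor>2 ^ j * t\<rfloor> / 2 ^ j - t) < r" by blast
  qed
  have n_eq: "real (n j) / 2 ^ j = real_of_int \<lfloor>2 ^ j * c\<rfloor> / 2 ^ j - real_of_int \<lfloor>2 ^ j * b\<rfloor> / 2 ^ j" for j
    using floor_le[of j] by (simp add: n_def diff_divide_distrib)
  have n_lim: "(\<lambda>j. real (n j) / 2 ^ j) \<longlonglongrightarrow> c - b"
    unfolding n_eq by (intro tendsto_diff floor_lim)
  show ?thesis
  proof (rule LIMSEQ_le)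
    show "(\<lambda>j. \<bar>x j \<lfloor>2 ^ j * c\<rfloor> - x j \<lfloor>2 ^ j * b\<rfloor> - real (n j) / 2 ^ j * m\<bar>)
        \<longlonglongrightarrow> \<bar>G c - G b - (c - b) * m\<bar>"
      by (intro tendsto_intros G n_lim)
    have "(\<lambda>j. real (n j) / 2 ^ j * (e + w j)) \<longlonglongrightarrow> (c - b) * (e + 0)"
      by (intro tendsto_intros n_lim w)
    then show "(\<lambda>j. real (n j) / 2 ^ j * (e + w j)) \<longlonglongrightarrow> (c - b) * e" by simp
    show "\<exists>N. \<forall>j\<ge>N. \<bar>x j \<lfloor>2 ^ j * c\<rfloor> - x j \<lfloor>2 ^ j * b\<rfloor> - real (n j) / 2 ^ j * m\<bar>
        \<le> real (n j) / 2 ^ j * (e + w j)"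
      using sum by blast
  qed
qed

lemma dyadic_limit_derivative:
  fixes x :: "nat \<Rightarrow> int \<Rightarrow> real"
  assumes G: "\<And>t. (\<lambda>j. x j \<lfloor>2 ^ j * t\<rfloor>) \<longlonglongrightarrow> G t"
    and D: "\<And>j t. j0 \<le> j \<Longrightarrow> \<bar>2 ^ j * fdiff (x j) \<lfloor>2 ^ j * t\<rfloor> - D t\<bar> \<le> w j"
    and w: "w \<longlonglongrightarrow> 0" and "isCont D a"
  shows "(G has_real_derivative D a) (at a)"
  unfolding DERIV_def
proof (rule LIM_I)
  fix r :: real assume "0 < r"
  then obtain s where s: "0 < s" "\<And>t. \<bar>t - a\<bar> < s \<Longrightarrow> \<bar>D t - D a\<bar> < r / 2"
    using \<open>isCont D a\<close> unfolding isCont_def LIM_def dist_real_def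
    by (metis abs_zero diff_self half_gt_zero)
  have "norm ((G (a + h) - G a) / h - D a) < r" if "h \<noteq> 0" "norm (h - 0) < s" for h
  proof -
    have "\<bar>G (a + h) - G a - h * D a\<bar> \<le> \<bar>h\<bar> * (r / 2)"
    proof (cases "0 < h")
      case True
      have "\<bar>G (a + h) - G a - (a + h - a) * D a\<bar> \<le> (a + h - a) * (r / 2)"
        using True that by (intro dyadic_limit_mean_value[OF G D w] less_imp_le[OF s(2)]) auto
      then show ?thesis using True by simp
    next
      case False
      have "\<bar>G a - G (a + h) - (a - (a + h)) * D a\<bar> \<le> (a - (a + h)) * (r / 2)"
        using False that by (intro dyadic_limit_mean_value[OF G D w] less_imp_le[OF s(2)]) auto
      then show ?thesis using False by (simp add: abs_le_iff)
    qed
    also have "\<dots> < \<bar>h\<bar> * r" using \<open>h \<noteq> 0\<close> \<open>0 < r\<close> by simp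
    finally have "\<bar>G (a + h) - G a - h * D a\<bar> / \<bar>h\<bar> < r" using \<open>h \<noteq> 0\<close> by (simp add: field_simps)
    moreover have "(G (a + h) - G a) / h - D a = (G (a + h) - G a - h * D a) / h"
      using \<open>h \<noteq> 0\<close> by (simp add: field_simps)
    ultimately show ?thesis by simp
  qed
  then show "\<exists>s>0. \<forall>h. h \<noteq> 0 \<and> norm (h - 0) < s \<longrightarrow> norm ((G (a + h) - G a) / h - D a) < r"
    using s(1) by blast
qed

text \<open>\<open>Delta^k S_p = 2 ^ -k * S_{p-k} Delta^k\<close>, so \<open>2 ^ (k * j)\<close> is
  the scaling under which the k-th differences are refined by plain averaging. The error picks up
  \<open>2 ^ k\<close> from the differences and \<open>2 ^ k\<close> from the change of
  level.\<close>

lemma scaled_fdiff_step: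
  fixes x x' :: "int \<Rightarrow> real"
  assumes "k \<le> p" and "\<And>K. \<bar>x' K - subdiv p x K\<bar> \<le> e"
  shows "\<bar>2 ^ (k * Suc j) * (fdiff ^^ k) x' K - subdiv (p - k) (\<lambda>i. 2 ^ (k * j) * (fdiff ^^ k) x i) K\<bar>
    \<le> 2 ^ (k * j) * 4 ^ k * e"
proof -
  have "subdiv (p - k) ((fdiff ^^ k) x) K = 2 ^ k * (fdiff ^^ k) (subdiv p x) K"
    using funpow_fdiff_subdiv[of k "p - k" x K] \<open>k \<le> p\<close> by simp
  then have "2 ^ (k * Suc j) * (fdiff ^^ k) x' K - subdiv (p - k) (\<lambda>i. 2 ^ (k * j) * (fdiff ^^ k) x i) K
      = 2 ^ (k * Suc j) * (fdiff ^^ k) (\<lambda>i. x' i - subdiv p x i) K"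
    unfolding subdiv_cmult funpow_fdiff_diff by (simp add: power_add algebra_simps)
  also have "\<bar>\<dots>\<bar> \<le> 2 ^ (k * Suc j) * (2 ^ k * e)"
    using abs_funpow_fdiff_le[OF assms(2), where k = k and i = K] by (simp add: abs_mult)
  also have "\<dots> = 2 ^ (k * j) * 4 ^ k * e"
    by (simp add: power_add power_mult_distrib[symmetric])
  finally show ?thesis .
qed

text \<open>Averaging does not increase the supremum and the perturbations are summable. The term
  \<open>2 * E / 2 ^ j\<close> subtracted in the induction is the sum of those still to
  come.\<close>

lemma perturbed_subdiv_bounded:
  fixes x :: "nat \<Rightarrow> int \<Rightarrow> real"
  assumes "0 \<le> E" and b: "\<And>i. \<bar>x j0 i\<bar> \<le> b"
    and step: "\<And>j K. j0 \<le> j \<Longrightarrow> \<bar>x (Suc j) K - subdiv q (x j) K\<bar> \<le> E / 2 ^ j"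
    and "j0 \<le> j"
  shows "\<bar>x j i\<bar> \<le> b + 2 * E"
proof -
  have "\<forall>i. \<bar>x j i\<bar> \<le> b + 2 * E - 2 * E / 2 ^ j"
    using \<open>j0 \<le> j\<close>
  proof (induction j rule: dec_induct)
    case base
    have "2 * E / 2 ^ j0 \<le> 2 * E / 1" using \<open>0 \<le> E\<close> by (intro divide_left_mono) auto
    then show ?case by (intro allI order_trans[OF b]) simp
  next
    case (step j)
    show ?case
    proof
      fix i
      have "\<bar>subdiv q (x j) i\<bar> \<le> b + 2 * E - 2 * E / 2 ^ j"
        using norm_subdiv_le[of i q "x j" "b + 2 * E - 2 * E / 2 ^ j"] step.IH by simp
      then have "\<bar>x (Suc j) i\<bar> \<le> b + 2 * E - 2 * E / 2 ^ j + E / 2 ^ j"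
        using assms(3)[OF step.hyps(1), of i] by (simp add: abs_le_iff)
      also have "\<dots> = b + 2 * E - 2 * E / 2 ^ Suc j" by (simp add: field_simps)
      finally show "\<bar>x (Suc j) i\<bar> \<le> b + 2 * E - 2 * E / 2 ^ Suc j" .
    qed
  qed
  then have "\<bar>x j i\<bar> \<le> b + 2 * E - 2 * E / 2 ^ j" by blast
  moreover have "0 \<le> 2 * E / 2 ^ j" using \<open>0 \<le> E\<close> by simp
  ultimately show ?thesis by linarith
qed

lemma perturbed_subdiv_linear_growth:
  fixes x :: "nat \<Rightarrow> int \<Rightarrow> real"
  assumes "0 \<le> E" and b: "\<And>i. \<bar>x j0 i\<bar> \<le> b"
    and step: "\<And>j K. j0 \<le> j \<Longrightarrow> \<bar>x (Suc j) K - subdiv q (x j) K\<bar> \<le> E"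
    and "j0 \<le> j"
  shows "\<bar>x j i\<bar> \<le> (b + E) * (real j + 1)"
proof -
  have "0 \<le> b" using b[of 0] by linarith
  have "\<forall>i. \<bar>x j i\<bar> \<le> b + E * real j"
    using \<open>j0 \<le> j\<close>
  proof (induction j rule: dec_induct)
    case base
    then show ?case using b \<open>0 \<le> E\<close> by (simp add: add_increasing2)
  next
    case (step j)
    show ?case
    proof
      fix i
      have "\<bar>subdiv q (x j) i\<bar> \<le> b + E * real j"
        using norm_subdiv_le[of i q "x j" "b + E * real j"] step.IH by simp
      then show "\<bar>x (Suc j) i\<bar> \<le> b + E * real (Suc j)"
        using assms(3)[OF step.hyps(1), of i] by (simp add: abs_le_iff algebra_simps)
    qed
  qed
  then have "\<bar>x j i\<bar> \<le> b + E * real j" by blast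
  also have "\<dots> \<le> (b + E) * (real j + 1)" using \<open>0 \<le> b\<close> \<open>0 \<le> E\<close> by (simp add: algebra_simps)
  finally show ?thesis .
qed

text \<open>The scaled k-th differences \<open>D k\<close> converge to the k-th derivative:
  \<open>D (Suc k)\<close> is the scaled difference of \<open>D k\<close>. Four orders must be
  followed although only three derivatives result, because the modulus of the third derivative comes
  from \<open>D 4\<close>; this requires \<open>S_{p-4}\<close>, hence \<open>4 \<le> p\<close>.
  Boundedness starts at \<open>k = 1\<close>, since \<open>\<sigma>\<close> itself may be
  unbounded.\<close>

lemma perturbed_subdiv_limit_smooth:
  fixes x :: "nat \<Rightarrow> int \<Rightarrow> real" and \<sigma> :: "real \<Rightarrow> real"
  assumes "4 \<le> p" and "0 \<le> E" and b: "\<And>i. \<bar>fdiff (x j0) i\<bar> \<le> b"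
    and e: "\<And>j K. j0 \<le> j \<Longrightarrow> \<bar>x (Suc j) K - subdiv p (x j) K\<bar> \<le> E / 16 ^ j"
    and lim: "\<And>t. (\<lambda>j. x j \<lfloor>2 ^ j * t\<rfloor>) \<longlonglongrightarrow> \<sigma> t"
  obtains G where "G 0 = \<sigma>"
    and "\<And>k t. k < 3 \<Longrightarrow> (G k has_real_derivative G (Suc k) t) (at t)"
    and "\<And>k. 1 \<le> k \<Longrightarrow> k \<le> 3 \<Longrightarrow> bounded (range (G k))"
    and "\<And>k \<alpha>. 1 \<le> k \<Longrightarrow> k \<le> 3 \<Longrightarrow> 0 < \<alpha> \<Longrightarrow> \<alpha> < 1 \<Longrightarrow> holder_continuous \<alpha> (G k)"
proof -
  define D where "D k j i = 2 ^ (k * j) * (fdiff ^^ k) (x j) i" for k j i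
  have fdiff_D: "2 ^ j * fdiff (D k j) i = D (Suc k) j i" for k j i
    by (simp add: D_def fdiff_def power_add algebra_simps)
  have D_step: "\<bar>D k (Suc j) K - subdiv (p - k) (D k j) K\<bar> \<le> 2 ^ (k * j) * 4 ^ k * (E / 16 ^ j)"
    if "j0 \<le> j" "k \<le> 4" for k j K
    unfolding D_def[abs_def] using that \<open>4 \<le> p\<close> by (intro scaled_fdiff_step e) auto
  have D_step_le: "\<bar>D k (Suc j) K - subdiv (p - k) (D k j) K\<bar> \<le> 256 * E / 2 ^ j"
    if "j0 \<le> j" "k \<le> 3" for k j K
  proof -
    have "(2::real) ^ (k * j) * 4 ^ k * (E / 16 ^ j) \<le> 2 ^ (3 * j) * 4 ^ 4 * (E / 16 ^ j)"
      using that \<open>0 \<le> E\<close> by (intro mult_right_mono mult_mono power_increasing mult_le_mono1) auto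
    also have "\<dots> = 256 * E / 2 ^ j"
    proof -
      have "(16::real) ^ j = 2 ^ (3 * j) * 2 ^ j"
        by (simp add: power_mult power_mult_distrib[symmetric])
      then show ?thesis by simp
    qed
    finally show ?thesis using D_step[of j k K] that by linarith
  qed
  \<comment> \<open>The critical order: the scaling cancels the decay of the error, and a
    perturbation of fixed size remains at every level.\<close>
  have D_step_4: "\<bar>D 4 (Suc j) K - subdiv (p - 4) (D 4 j) K\<bar> \<le> 256 * E" if "j0 \<le> j" for j K
    using D_step[OF that, of 4 K] by (simp add: power_mult)
  have "0 \<le> b" using b[of 0] by linarith
  define c where "c = 2 ^ (4 * j0) * (2 ^ 3 * b)"
  have "0 \<le> c" using \<open>0 \<le> b\<close> by (simp add: c_def)
  have D_init: "\<bar>D k j0 i\<bar> \<le> c" if "1 \<le> k" "k \<le> 4" for k i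
  proof -
    obtain l where l: "k = Suc l" "l \<le> 3" using \<open>1 \<le> k\<close> \<open>k \<le> 4\<close> by (cases k) auto
    have "\<bar>(fdiff ^^ k) (x j0) i\<bar> \<le> 2 ^ l * b"
      unfolding l funpow_Suc_right o_def by (rule abs_funpow_fdiff_le) (rule b)
    also have "\<dots> \<le> 2 ^ 3 * b"
      using l \<open>0 \<le> b\<close> by (intro mult_right_mono power_increasing) auto
    finally have "2 ^ (k * j0) * \<bar>(fdiff ^^ k) (x j0) i\<bar> \<le> 2 ^ (4 * j0) * (2 ^ 3 * b)"
      using that \<open>0 \<le> b\<close> by (intro mult_mono power_increasing) auto
    then show ?thesis by (simp add: D_def c_def abs_mult)
  qed
  define B where "B = c + 512 * E"
  have "0 \<le> B" using \<open>0 \<le> c\<close> \<open>0 \<le> E\<close> by (simp add: B_def)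
  have D_bound: "\<bar>D k j i\<bar> \<le> B" if "1 \<le> k" "k \<le> 3" "j0 \<le> j" for k j i
    using perturbed_subdiv_bounded[of "256 * E" "D k" j0 c "p - k" j i] that \<open>0 \<le> E\<close> D_init D_step_le
    by (simp add: B_def)
  have D_growth: "\<bar>D k j i\<bar> \<le> B * (real j + 1)" if "1 \<le> k" "k \<le> 4" "j0 \<le> j" for k j i
  proof (cases "k = 4")
    case True
    have "\<bar>D 4 j i\<bar> \<le> (c + 256 * E) * (real j + 1)"
      using perturbed_subdiv_linear_growth[of "256 * E" "D 4" j0 c "p - 4" j i] that \<open>0 \<le> E\<close> D_init D_step_4
      by simp
    also have "\<dots> \<le> B * (real j + 1)" using \<open>0 \<le> E\<close> by (intro mult_right_mono) (auto simp: B_def)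
    finally show ?thesis using True by simp
  next
    case False
    then have "\<bar>D k j i\<bar> \<le> B" using that by (intro D_bound) auto
    also have "\<dots> \<le> B * (real j + 1)" using \<open>0 \<le> B\<close> mult_left_mono[of 1 "real j + 1" B] by simp
    finally show ?thesis .
  qed
  \<comment> \<open>Approximation and modulus are bundled, so that the choice below picks a single
    limit function for each \<open>k\<close> having both properties.\<close>
  define P where "P k g W \<longleftrightarrow>
      (\<forall>j\<ge>j0. \<forall>t. \<bar>D k j \<lfloor>2 ^ j * t\<rfloor> - g t\<bar> \<le> W * (real j + 2) / 2 ^ j) \<and>
      (\<forall>j\<ge>j0. \<forall>t t'. \<bar>t - t'\<bar> \<le> 1 / 2 ^ j \<longrightarrow> \<bar>g t - g t'\<bar> \<le> W * (real j + 2) / 2 ^ j)"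
    for k and g :: "real \<Rightarrow> real" and W
  have "\<exists>g W. P k g W" if "k \<le> 3" for k
  proof -
    have 1: "\<bar>fdiff (D k j) i\<bar> \<le> B * (real j + 1) / 2 ^ j" if "j0 \<le> j" for j i
    proof -
      have "\<bar>2 ^ j * fdiff (D k j) i\<bar> \<le> B * (real j + 1)"
        unfolding fdiff_D using that \<open>k \<le> 3\<close> by (intro D_growth) auto
      then show ?thesis by (simp add: abs_mult field_simps)
    qed
    have 2: "\<bar>D k (Suc j) K - subdiv (p - k) (D k j) K\<bar> \<le> B / 2 ^ j" if "j0 \<le> j" for j K
    proof -
      have "256 * E / 2 ^ j \<le> B / 2 ^ j"
        using \<open>0 \<le> c\<close> \<open>0 \<le> E\<close> by (intro divide_right_mono) (auto simp: B_def)
      then show ?thesis using D_step_le[OF that \<open>k \<le> 3\<close>, of K] by linarith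
    qed
    obtain g :: "real \<Rightarrow> real" and W
      where "\<And>j t. j0 \<le> j \<Longrightarrow> \<bar>D k j \<lfloor>2 ^ j * t\<rfloor> - g t\<bar> \<le> W * (real j + 2) / 2 ^ j"
        and "\<And>j t t'. j0 \<le> j \<Longrightarrow> \<bar>t - t'\<bar> \<le> 1 / 2 ^ j \<Longrightarrow> \<bar>g t - g t'\<bar> \<le> W * (real j + 2) / 2 ^ j"
      using dyadic_limit[of B j0 "D k" "p - k", OF \<open>0 \<le> B\<close> 1 2] by blast
    then show ?thesis unfolding P_def by blast
  qed
  then have "\<forall>k. \<exists>g. k \<le> 3 \<longrightarrow> (\<exists>W. P k g W)" by blast
  then obtain G where G: "\<And>k. k \<le> 3 \<Longrightarrow> \<exists>W. P k (G k) W" by metis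
  have G_near: "\<exists>W. \<forall>j\<ge>j0. \<forall>t. \<bar>D k j \<lfloor>2 ^ j * t\<rfloor> - G k t\<bar> \<le> W * (real j + 2) / 2 ^ j" if "k \<le> 3" for k
    using G[OF that] unfolding P_def by blast
  have G_mod: "\<exists>W. \<forall>j\<ge>j0. \<forall>t t'. \<bar>t - t'\<bar> \<le> 1 / 2 ^ j \<longrightarrow> \<bar>G k t - G k t'\<bar> \<le> W * (real j + 2) / 2 ^ j"
    if "k \<le> 3" for k
    using G[OF that] unfolding P_def by blast
  have w_lim: "(\<lambda>j. W * (real j + 2) / 2 ^ j) \<longlonglongrightarrow> 0" for W
    using tendsto_mult[OF tendsto_const linear_over_exponential[of 2], of W] by simp
  have G_lim: "(\<lambda>j. D k j \<lfloor>2 ^ j * t\<rfloor>) \<longlonglongrightarrow> G k t" if "k \<le> 3" for k t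
  proof -
    obtain W where W: "\<And>j. j0 \<le> j \<Longrightarrow> \<bar>D k j \<lfloor>2 ^ j * t\<rfloor> - G k t\<bar> \<le> W * (real j + 2) / 2 ^ j"
      using G_near[OF \<open>k \<le> 3\<close>] by blast
    have "(\<lambda>j. D k j \<lfloor>2 ^ j * t\<rfloor> - G k t) \<longlonglongrightarrow> 0"
      by (rule Lim_null_comparison[OF _ w_lim[of W]]) (auto intro: eventually_sequentiallyI[of j0] W)
    then show ?thesis by (simp add: LIM_zero_iff)
  qed
  have bdd: "\<exists>b. \<forall>t. \<bar>G k t\<bar> \<le> b" if "1 \<le> k" "k \<le> 3" for k
  proof -
    have "\<bar>G k t\<bar> \<le> B" for t
    proof (rule LIMSEQ_le_const2)
      show "(\<lambda>j. \<bar>D k j \<lfloor>2 ^ j * t\<rfloor>\<bar>) \<longlonglongrightarrow> \<bar>G k t\<bar>" by (intro tendsto_rabs G_lim that)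
      show "\<exists>n. \<forall>j\<ge>n. \<bar>D k j \<lfloor>2 ^ j * t\<rfloor>\<bar> \<le> B" using D_bound[OF that] by blast
    qed
    then show ?thesis by blast
  qed
  have holder: "holder_continuous \<alpha> (G k)" if "1 \<le> k" "k \<le> 3" "0 < \<alpha>" "\<alpha> < 1" for k \<alpha>
  proof -
    obtain b where b: "\<And>t. \<bar>G k t\<bar> \<le> b" using bdd[OF \<open>1 \<le> k\<close> \<open>k \<le> 3\<close>] by blast
    obtain W where "\<And>j t t'. j0 \<le> j \<Longrightarrow> \<bar>t - t'\<bar> \<le> 1 / 2 ^ j \<Longrightarrow> \<bar>G k t - G k t'\<bar> \<le> W * (real j + 2) / 2 ^ j"
      using G_mod[OF \<open>k \<le> 3\<close>] by blast
    from this b that(3,4) show ?thesis by (rule holder_of_dyadic_modulus)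
  qed
  show ?thesis
  proof (rule that)
    show "G 0 = \<sigma>"
    proof
      fix t
      have "(\<lambda>j. x j \<lfloor>2 ^ j * t\<rfloor>) \<longlonglongrightarrow> G 0 t" using G_lim[of 0 t] by (simp add: D_def)
      then show "G 0 t = \<sigma> t" using lim LIMSEQ_unique by blast
    qed
    fix k t assume "k < (3::nat)"
    obtain W where W: "\<And>j t. j0 \<le> j \<Longrightarrow> \<bar>D (Suc k) j \<lfloor>2 ^ j * t\<rfloor> - G (Suc k) t\<bar> \<le> W * (real j + 2) / 2 ^ j"
      using G_near[of "Suc k"] \<open>k < 3\<close> by auto
    show "(G k has_real_derivative G (Suc k) t) (at t)"
    proof (rule dyadic_limit_derivative)
      show "(\<lambda>j. D k j \<lfloor>2 ^ j * t\<rfloor>) \<longlonglongrightarrow> G k t" for t using \<open>k < 3\<close> by (intro G_lim) simp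
      show "\<bar>2 ^ j * fdiff (D k j) \<lfloor>2 ^ j * t\<rfloor> - G (Suc k) t\<bar> \<le> W * (real j + 2) / 2 ^ j" if "j0 \<le> j" for j t
        unfolding fdiff_D using that by (rule W)
      show "(\<lambda>j. W * (real j + 2) / 2 ^ j) \<longlonglongrightarrow> 0" by (rule w_lim)
      show "isCont (G (Suc k)) t"
        using \<open>k < 3\<close> by (intro holder_imp_continuous[of "1 / 2"] holder) auto
    qed
  next
    fix k :: nat assume "1 \<le> k" "k \<le> 3"
    then show "bounded (range (G k))" using bdd[of k] by (auto simp: bounded_iff)
  qed (rule holder)
qed

section \<open>Hoelder functions and iterated derivatives\<close>

text \<open>Boundedness is included because a product of Hoelder functions on the whole line need
  not be Hoelder without it.\<close>

definition bounded_holder :: "real \<Rightarrow> (real \<Rightarrow> 'a::real_normed_vector) \<Rightarrow> bool" where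
  "bounded_holder \<alpha> f \<longleftrightarrow> bounded (range f) \<and> holder_continuous \<alpha> f"

lemma bounded_holder_add:
  assumes "bounded_holder \<alpha> f" "bounded_holder \<alpha> g"
  shows "bounded_holder \<alpha> (\<lambda>t. f t + g t)"
proof -
  obtain a b where ab: "\<And>t. norm (f t) \<le> a" "\<And>t. norm (g t) \<le> b"
    using assms unfolding bounded_holder_def bounded_iff by auto
  obtain A B where AB: "\<And>x y. norm (f x - f y) \<le> A * \<bar>x - y\<bar> powr \<alpha>"
      "\<And>x y. norm (g x - g y) \<le> B * \<bar>x - y\<bar> powr \<alpha>"
    using assms unfolding bounded_holder_def holder_continuous_def by auto
  have "norm (f t + g t) \<le> a + b" for t
    using ab[of t] by (intro norm_triangle_le) simp
  moreover have "norm (f x + g x - (f y + g y)) \<le> (A + B) * \<bar>x - y\<bar> powr \<alpha>" for x y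
    unfolding add_diff_add distrib_right using AB by (intro norm_triangle_le add_mono)
  ultimately show ?thesis
    unfolding bounded_holder_def bounded_iff holder_continuous_def by blast
qed

lemma bounded_holder_scaleR:
  assumes "bounded_holder \<alpha> f" "bounded_holder \<alpha> g"
  shows "bounded_holder \<alpha> (\<lambda>t. f t *\<^sub>R g t)"
proof -
  obtain a b where ab: "\<And>t. norm (f t) \<le> a" "\<And>t. norm (g t) \<le> b"
    using assms unfolding bounded_holder_def bounded_iff by auto
  obtain A B where AB: "\<And>x y. norm (f x - f y) \<le> A * \<bar>x - y\<bar> powr \<alpha>"
      "\<And>x y. norm (g x - g y) \<le> B * \<bar>x - y\<bar> powr \<alpha>"
    using assms unfolding bounded_holder_def holder_continuous_def by auto
  have a0: "0 \<le> a" using order_trans[OF norm_ge_zero ab(1)] .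
  have "norm (f t *\<^sub>R g t) \<le> a * b" for t
    unfolding norm_scaleR using ab[of t] a0 by (intro mult_mono) auto
  moreover have "norm (f x *\<^sub>R g x - f y *\<^sub>R g y) \<le> (a * B + A * b) * \<bar>x - y\<bar> powr \<alpha>" for x y
  proof -
    have "f x *\<^sub>R g x - f y *\<^sub>R g y = f x *\<^sub>R (g x - g y) + (f x - f y) *\<^sub>R g y"
      by (simp add: scaleR_right.diff scaleR_left.diff)
    also have "norm \<dots> \<le> a * (B * \<bar>x - y\<bar> powr \<alpha>) + (A * \<bar>x - y\<bar> powr \<alpha>) * b"
    proof (intro norm_triangle_le add_mono)
      show "norm (f x *\<^sub>R (g x - g y)) \<le> a * (B * \<bar>x - y\<bar> powr \<alpha>)"
        unfolding norm_scaleR using ab(1)[of x] AB(2)[of x y] a0 by (intro mult_mono) auto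
      show "norm ((f x - f y) *\<^sub>R g y) \<le> (A * \<bar>x - y\<bar> powr \<alpha>) * b"
        unfolding norm_scaleR using ab(2)[of y] AB(1)[of x y] order_trans[OF norm_ge_zero AB(1)[of x y]]
        by (intro mult_mono) auto
    qed
    finally show ?thesis by (simp add: algebra_simps)
  qed
  ultimately show ?thesis
    unfolding bounded_holder_def bounded_iff holder_continuous_def by blast
qed

lemma bounded_holder_const: "bounded_holder \<alpha> (\<lambda>t. c)"
  by (auto simp: bounded_holder_def holder_continuous_def intro!: exI[of _ 0])

lemma bounded_holder_mult:
  fixes f g :: "real \<Rightarrow> real"
  assumes "bounded_holder \<alpha> f" "bounded_holder \<alpha> g"
  shows "bounded_holder \<alpha> (\<lambda>t. f t * g t)"
  using bounded_holder_scaleR[OF assms] by simp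

text \<open>Up to distance 1 the distance is below its own power \<open>\<alpha>\<close>; beyond 1
  the bound on \<open>g\<close> suffices.\<close>

lemma bounded_holder_compose_lipschitz:
  fixes g :: "real \<Rightarrow> 'a::real_normed_vector"
  assumes g: "\<And>t. norm (g t) \<le> M" "\<And>x y. norm (g x - g y) \<le> M * \<bar>x - y\<bar>"
    and \<sigma>: "\<And>x y. \<bar>\<sigma> x - \<sigma> y\<bar> \<le> \<Lambda> * \<bar>x - y\<bar>" and \<alpha>: "0 < \<alpha>" "\<alpha> < 1"
  shows "bounded_holder \<alpha> (\<lambda>t. g (\<sigma> t))"
proof -
  have "0 \<le> M" using order_trans[OF norm_ge_zero g(1)] .
  have "0 \<le> \<Lambda>" using order_trans[OF abs_ge_zero \<sigma>[of 1 0]] by simp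
  have "norm (g (\<sigma> x) - g (\<sigma> y)) \<le> (M * \<Lambda> + 2 * M) * \<bar>x - y\<bar> powr \<alpha>" for x y
  proof (cases "\<bar>x - y\<bar> \<le> 1")
    case True
    have "norm (g (\<sigma> x) - g (\<sigma> y)) \<le> M * (\<Lambda> * \<bar>x - y\<bar>)"
      using g(2)[of "\<sigma> x" "\<sigma> y"] mult_left_mono[OF \<sigma>[of x y] \<open>0 \<le> M\<close>] by linarith
    also have "\<dots> \<le> M * (\<Lambda> * \<bar>x - y\<bar> powr \<alpha>)"
    proof (intro mult_left_mono \<open>0 \<le> M\<close> \<open>0 \<le> \<Lambda>\<close>)
      show "\<bar>x - y\<bar> \<le> \<bar>x - y\<bar> powr \<alpha>"
        using powr_mono'[of \<alpha> 1 "\<bar>x - y\<bar>"] \<alpha> True by simp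
    qed
    also have "\<dots> \<le> (M * \<Lambda> + 2 * M) * \<bar>x - y\<bar> powr \<alpha>" using \<open>0 \<le> M\<close> by (simp add: algebra_simps)
    finally show ?thesis .
  next
    case False
    then have "1 \<le> \<bar>x - y\<bar> powr \<alpha>" using \<alpha> by (intro ge_one_powr_ge_zero) auto
    have "norm (g (\<sigma> x) - g (\<sigma> y)) \<le> M + M"
      using g(1)[of "\<sigma> x"] g(1)[of "\<sigma> y"] norm_triangle_ineq4[of "g (\<sigma> x)" "g (\<sigma> y)"] by linarith
    also have "\<dots> \<le> (M * \<Lambda> + 2 * M) * 1" using \<open>0 \<le> M\<close> \<open>0 \<le> \<Lambda>\<close> by simp
    also have "\<dots> \<le> (M * \<Lambda> + 2 * M) * \<bar>x - y\<bar> powr \<alpha>"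
      using \<open>0 \<le> M\<close> \<open>0 \<le> \<Lambda>\<close> \<open>1 \<le> \<bar>x - y\<bar> powr \<alpha>\<close> by (intro mult_left_mono) auto
    finally show ?thesis .
  qed
  then show ?thesis
    using g(1) unfolding bounded_holder_def holder_continuous_def bounded_iff by blast
qed

section \<open>Iterated derivatives from explicit families of derivatives\<close>

lemma nth_vderiv_eq:
  assumes "\<And>k t. k < n \<Longrightarrow> (f k has_vector_derivative f (Suc k) t) (at t)" "k \<le> n"
  shows "nth_vderiv k (f 0) = f k"
  using assms(2)
proof (induction k)
  case (Suc k)
  have "nth_vderiv (Suc k) (f 0) = (\<lambda>t. vector_derivative (nth_vderiv k (f 0)) (at t))"
    by (simp add: nth_vderiv_def)
  also have "nth_vderiv k (f 0) = f k" using Suc by simp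
  also have "(\<lambda>t. vector_derivative (f k) (at t)) = f (Suc k)"
    using assms(1)[of k] Suc.prems by (auto intro!: vector_derivative_at)
  finally show ?case .
qed (simp add: nth_vderiv_def)

lemma C_k_of_derivatives:
  assumes der: "\<And>k t. k < n \<Longrightarrow> (f k has_vector_derivative f (Suc k) t) (at t)"
    and "continuous_on UNIV (f n)"
  shows "C_k n (f 0)"
proof -
  have nth: "nth_vderiv k (f 0) = f k" if "k \<le> n" for k
    using nth_vderiv_eq[where f = f and n = n and k = k] der that by blast
  have "nth_vderiv i (f 0) differentiable at t" if "i < n" for i t
    using der[OF that, of t] nth[of i] that by (auto intro: differentiableI_vector)
  moreover have "continuous_on UNIV (nth_vderiv n (f 0))"
    using assms(2) nth[of n] by simp
  ultimately show ?thesis unfolding C_k_def by blast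
qed

lemma C_k_has_vector_derivative:
  assumes "C_k n f" "k < n"
  shows "(nth_vderiv k f has_vector_derivative nth_vderiv (Suc k) f t) (at t)"
  using assms vector_derivative_works[of "nth_vderiv k f" "at t"]
  by (simp add: C_k_def nth_vderiv_def)

section \<open>Periodicity and uniform convergence of the nodes\<close>

lemma periodic_shift:
  fixes f :: "real \<Rightarrow> 'a"
  assumes "\<And>t. f (t + L) = f t"
  shows "f (t + of_int n * L) = f t"
proof -
  have nat: "f (t + real n * L) = f t" for n t
  proof (induction n)
    case (Suc n)
    then show ?case using assms[of "t + real n * L"] by (simp add: algebra_simps)
  qed simp
  show ?thesis
  proof (cases "0 \<le> n")
    case True
    then show ?thesis using nat[of t "nat n"] by simp
  next
    case False
    then show ?thesis using nat[of "t + of_int n * L" "nat (- n)"] by simp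
  qed
qed

lemma periodic_continuous_bounded:
  fixes f :: "real \<Rightarrow> 'a::real_normed_vector"
  assumes "continuous_on UNIV f" and per: "\<And>t. f (t + L) = f t" and "0 < L"
  obtains M where "\<And>t. norm (f t) \<le> M"
proof -
  have "compact (f ` {0..L})"
    using assms(1) by (intro compact_continuous_image) (auto intro: continuous_on_subset)
  then obtain M where M: "\<And>t. t \<in> {0..L} \<Longrightarrow> norm (f t) \<le> M"
    by (meson bounded_iff compact_imp_bounded imageI)
  have "norm (f t) \<le> M" for t
  proof -
    define n where "n = \<lfloor>t / L\<rfloor>"
    have "of_int n \<le> t / L" "t / L < of_int n + 1" unfolding n_def by linarith+
    then have "t - of_int n * L \<in> {0..L}" using \<open>0 < L\<close> by (simp add: field_simps)
    then show ?thesis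
      using M[of "t - of_int n * L"] periodic_shift[of f L "t - of_int n * L" n] per by simp
  qed
  then show ?thesis using that by blast
qed

text \<open>Removing the linear drift \<open>t / N * L\<close> leaves a continuous periodic
  function, to which compactness applies; the drift is Lipschitz.\<close>

lemma uniformly_continuous_of_shift:
  fixes f :: "real \<Rightarrow> real"
  assumes "continuous_on UNIV f" and shift: "\<And>t. f (t + N) = f t + L" and "0 < N"
  shows "uniformly_continuous_on UNIV f"
proof -
  define g where "g t = f t - t / N * L" for t
  have g_per: "g (t + N) = g t" for t
    using \<open>0 < N\<close> by (simp add: g_def shift add_divide_distrib distrib_right)
  have g_cont: "continuous_on UNIV g"
    unfolding g_def using assms(1) \<open>0 < N\<close> by (intro continuous_intros) auto
  \<comment> \<open>One extra period on each side, so that after moving \<open>x\<close> into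
    \<open>[0, N]\<close> a neighbour closer than \<open>N\<close> still lies in the
    interval.\<close>
  have "uniformly_continuous_on {-N..2 * N} g"
    by (rule compact_uniformly_continuous) (auto intro: continuous_on_subset[OF g_cont])
  have "uniformly_continuous_on UNIV g"
    unfolding uniformly_continuous_on_def
  proof (intro allI impI)
    fix e :: real assume "0 < e"
    then obtain d where d: "0 < d"
        "\<And>x x'. x \<in> {-N..2 * N} \<Longrightarrow> x' \<in> {-N..2 * N} \<Longrightarrow> dist x' x < d \<Longrightarrow> dist (g x') (g x) < e"
      using \<open>uniformly_continuous_on {-N..2 * N} g\<close> unfolding uniformly_continuous_on_def by blast
    have "dist (g x') (g x) < e" if "dist x' x < min d N" for x x'
    proof -
      define n where "n = \<lfloor>x / N\<rfloor>"
      have "of_int n \<le> x / N" "x / N < of_int n + 1" unfolding n_def by linarith+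
      then have x: "0 \<le> x - of_int n * N" "x - of_int n * N \<le> N" using \<open>0 < N\<close> by (auto simp: field_simps)
      have "\<bar>x' - x\<bar> < N" using that by (simp add: dist_real_def)
      then have "dist (g (x' - of_int n * N)) (g (x - of_int n * N)) < e"
        using that x by (intro d(2)) (auto simp: dist_real_def)
      then show ?thesis
        using periodic_shift[of g N "x - of_int n * N" n] periodic_shift[of g N "x' - of_int n * N" n] g_per
        by simp
    qed
    then show "\<exists>d>0. \<forall>x\<in>UNIV. \<forall>x'\<in>UNIV. dist x' x < d \<longrightarrow> dist (g x') (g x) < e"
      using d(1) \<open>0 < N\<close> by (intro exI[of _ "min d N"]) auto
  qed
  moreover have "uniformly_continuous_on UNIV (\<lambda>t. t / N * L)"
    using bounded_linear.uniformly_continuous_on[OF bounded_linear_mult_right[of "L / N"]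
        uniformly_continuous_on_id, of UNIV] by (simp add: mult.commute)
  ultimately have "uniformly_continuous_on UNIV (\<lambda>t. g t + t / N * L)"
    by (rule uniformly_continuous_on_add)
  then show ?thesis by (simp add: g_def)
qed

section \<open>Node values as samples of the piecewise linear interpolants\<close>

lemma pl_interpolant_node: "pl_interpolant j x (of_int i / 2 ^ j) = x i"
  by (simp add: pl_interpolant_def)

lemma pl_interpolant_shift:
  fixes x :: "int \<Rightarrow> real"
  assumes "\<And>i. x (i + 2 ^ j * int N) = x i + L"
  shows "pl_interpolant j x (t + real N) = pl_interpolant j x t + L"
proof -
  have floor: "\<lfloor>2 ^ j * (t + real N)\<rfloor> = \<lfloor>2 ^ j * t\<rfloor> + 2 ^ j * int N"
  proof -
    have "2 ^ j * (t + real N) = 2 ^ j * t + of_int (2 ^ j * int N)" by (simp add: algebra_simps)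
    then show ?thesis by (simp only: floor_add_int)
  qed
  have 1: "x (\<lfloor>2 ^ j * t\<rfloor> + 2 ^ j * int N + 1) = x (\<lfloor>2 ^ j * t\<rfloor> + 1) + L"
    using assms[of "\<lfloor>2 ^ j * t\<rfloor> + 1"] by (simp add: algebra_simps)
  show ?thesis
    unfolding pl_interpolant_def Let_def floor 1 assms by (simp add: algebra_simps)
qed

text \<open>\<open>\<sigma>\<close> inherits the shift law of the nodes and is therefore uniformly
  continuous on the line. The constant \<open>C\<close> allows a node to be compared with
  \<open>\<sigma>\<close> at a point several cells away.\<close>

lemma nodes_converge_uniformly:
  assumes conv: "converges_to s \<sigma>" and "0 < N"
    and shift: "\<And>j i. s j (i + 2 ^ j * int N) = s j i + L" and "0 < \<epsilon>"
  obtains j0 where "\<And>j i t. j0 \<le> j \<Longrightarrow> \<bar>t - of_int i / 2 ^ j\<bar> \<le> C / 2 ^ j \<Longrightarrow> \<bar>s j i - \<sigma> t\<bar> \<le> \<epsilon>"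
proof -
  have unif: "uniform_limit UNIV (\<lambda>j. pl_interpolant j (s j)) \<sigma> sequentially"
    and cont: "continuous_on UNIV \<sigma>"
    using conv by (auto simp: converges_to_def)
  have pl_shift: "pl_interpolant j (s j) (t + real N) = pl_interpolant j (s j) t + L" for j t
    by (rule pl_interpolant_shift) (rule shift)
  have "\<sigma> (t + real N) = \<sigma> t + L" for t
  proof (rule LIMSEQ_unique)
    show "(\<lambda>j. pl_interpolant j (s j) (t + real N)) \<longlonglongrightarrow> \<sigma> (t + real N)"
      using tendsto_uniform_limitI[OF unif] by blast
    show "(\<lambda>j. pl_interpolant j (s j) (t + real N)) \<longlonglongrightarrow> \<sigma> t + L"
      unfolding pl_shift
      using tendsto_uniform_limitI[OF unif] by (intro tendsto_add tendsto_const) blast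
  qed
  then have "uniformly_continuous_on UNIV \<sigma>"
    using cont \<open>0 < N\<close> by (intro uniformly_continuous_of_shift[of \<sigma> "real N" L]) auto
  then obtain d where d: "0 < d" "\<And>t t'. \<bar>t' - t\<bar> < d \<Longrightarrow> \<bar>\<sigma> t' - \<sigma> t\<bar> < \<epsilon> / 2"
    using \<open>0 < \<epsilon>\<close> unfolding uniformly_continuous_on_def dist_real_def by (metis UNIV_I half_gt_zero)
  obtain j1 where j1: "\<And>j t. j1 \<le> j \<Longrightarrow> \<bar>pl_interpolant j (s j) t - \<sigma> t\<bar> < \<epsilon> / 2"
    using uniform_limitD[OF unif, of "\<epsilon> / 2"] \<open>0 < \<epsilon>\<close>
    unfolding eventually_sequentially dist_real_def by auto
  have "(\<lambda>j. C * (1 / 2) ^ j) \<longlonglongrightarrow> C * 0" by (intro tendsto_intros LIMSEQ_power_zero) auto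
  then have "\<forall>\<^sub>F j in sequentially. C * (1 / 2) ^ j < d" using d(1) by (simp add: order_tendstoD)
  then obtain j2 where j2: "\<And>j. j2 \<le> j \<Longrightarrow> C / 2 ^ j < d"
    unfolding eventually_sequentially by (auto simp: power_divide)
  show ?thesis
  proof (rule that[of "max j1 j2"])
    fix j i and t :: real assume j: "max j1 j2 \<le> j" and t: "\<bar>t - of_int i / 2 ^ j\<bar> \<le> C / 2 ^ j"
    have "\<bar>s j i - \<sigma> (of_int i / 2 ^ j)\<bar> < \<epsilon> / 2"
      using j1[of j "of_int i / 2 ^ j"] j by (simp add: pl_interpolant_node)
    moreover have "\<bar>\<sigma> t - \<sigma> (of_int i / 2 ^ j)\<bar> < \<epsilon> / 2" using d(2) t j2[of j] j by force
    ultimately show "\<bar>s j i - \<sigma> t\<bar> \<le> \<epsilon>" by linarith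
  qed
qed

lemma nodes_tendsto_limit:
  assumes "converges_to s \<sigma>" and "0 < N" and "\<And>j i. s j (i + 2 ^ j * int N) = s j i + L"
  shows "(\<lambda>j. s j \<lfloor>2 ^ j * t\<rfloor>) \<longlonglongrightarrow> \<sigma> t"
proof (rule LIMSEQ_I)
  fix r :: real assume "0 < r"
  then have "0 < r / 2" by simp
  obtain j0 where j0: "\<And>j i t. j0 \<le> j \<Longrightarrow> \<bar>t - of_int i / 2 ^ j\<bar> \<le> 1 / 2 ^ j \<Longrightarrow> \<bar>s j i - \<sigma> t\<bar> \<le> r / 2"
    using nodes_converge_uniformly[OF assms \<open>0 < r / 2\<close>, where C = 1] by blast
  have "norm (s j \<lfloor>2 ^ j * t\<rfloor> - \<sigma> t) < r" if "j0 \<le> j" for j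
  proof -
    have "\<bar>2 ^ j * t - of_int \<lfloor>2 ^ j * t\<rfloor>\<bar> / 2 ^ j \<le> 1 / 2 ^ j"
      by (intro divide_right_mono) (linarith, simp)
    moreover have "t - of_int \<lfloor>2 ^ j * t\<rfloor> / 2 ^ j = (2 ^ j * t - of_int \<lfloor>2 ^ j * t\<rfloor>) / 2 ^ j"
      by (simp add: field_simps)
    ultimately have "\<bar>s j \<lfloor>2 ^ j * t\<rfloor> - \<sigma> t\<bar> \<le> r / 2" by (intro j0[OF that]) (simp add: abs_divide)
    then show ?thesis using \<open>0 < r\<close> by simp
  qed
  then show "\<exists>n. \<forall>j\<ge>n. norm (s j \<lfloor>2 ^ j * t\<rfloor> - \<sigma> t) < r" by blast
qed

text \<open>Supplies the two smallness conditions of the one-step estimates, on the new parameter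
  and on the span of the stencil. All nodes involved are compared with the value of
  \<open>\<sigma>\<close> at one common point.\<close>

lemma nodes_close:
  assumes "converges_to s \<sigma>" and "0 < N" and "\<And>j i. s j (i + 2 ^ j * int N) = s j i + L" and "0 < \<epsilon>"
  obtains j0 where "\<And>j K. j0 \<le> j \<Longrightarrow> \<bar>s (Suc j) K - s j (K div 2)\<bar> \<le> \<epsilon>"
    and "\<And>j i k. j0 \<le> j \<Longrightarrow> \<bar>i - k\<bar> \<le> int n \<Longrightarrow> \<bar>s j i - s j k\<bar> \<le> \<epsilon>"
proof -
  have "0 < \<epsilon> / 2" using \<open>0 < \<epsilon>\<close> by simp
  obtain j0 where j0: "\<And>j i t. j0 \<le> j \<Longrightarrow> \<bar>t - of_int i / 2 ^ j\<bar> \<le> (real n + 1) / 2 ^ j \<Longrightarrow> \<bar>s j i - \<sigma> t\<bar> \<le> \<epsilon> / 2"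
    using nodes_converge_uniformly[OF assms(1-3) \<open>0 < \<epsilon> / 2\<close>, where C = "real n + 1"] by blast
  show ?thesis
  proof (rule that[of j0])
    fix j K assume j: "j0 \<le> j"
    define t :: real where "t = of_int K / 2 ^ Suc j"
    have "\<bar>s (Suc j) K - \<sigma> t\<bar> \<le> \<epsilon> / 2" using j by (intro j0) (auto simp: t_def)
    moreover have "\<bar>s j (K div 2) - \<sigma> t\<bar> \<le> \<epsilon> / 2"
    proof (rule j0[OF j])
      have "2 * (K div 2) \<le> K" "K \<le> 2 * (K div 2) + 1" by linarith+
      then have "real_of_int (2 * (K div 2)) \<le> real_of_int K" "real_of_int K \<le> real_of_int (2 * (K div 2) + 1)"
        by (simp_all only: of_int_le_iff)
      then have "\<bar>real_of_int K / 2 - of_int (K div 2)\<bar> \<le> real n + 1" by (simp add: abs_le_iff)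
      then have "\<bar>real_of_int K / 2 - of_int (K div 2)\<bar> / 2 ^ j \<le> (real n + 1) / 2 ^ j"
        by (intro divide_right_mono) auto
      moreover have "t - of_int (K div 2) / 2 ^ j = (real_of_int K / 2 - of_int (K div 2)) / 2 ^ j"
        by (simp add: t_def field_simps)
      ultimately show "\<bar>t - of_int (K div 2) / 2 ^ j\<bar> \<le> (real n + 1) / 2 ^ j" by (simp add: abs_divide)
    qed
    moreover have "\<bar>a - b\<bar> \<le> \<epsilon>" if "\<bar>a - c\<bar> \<le> \<epsilon> / 2" "\<bar>b - c\<bar> \<le> \<epsilon> / 2" for a b c
      using that by linarith
    ultimately show "\<bar>s (Suc j) K - s j (K div 2)\<bar> \<le> \<epsilon>" by blast
  next
    fix j i k assume j: "j0 \<le> j" and ik: "\<bar>i - k\<bar> \<le> int n"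
    define t :: real where "t = of_int k / 2 ^ j"
    have "\<bar>s j k - \<sigma> t\<bar> \<le> \<epsilon> / 2" using j by (intro j0) (auto simp: t_def)
    moreover have "\<bar>s j i - \<sigma> t\<bar> \<le> \<epsilon> / 2"
    proof (rule j0[OF j])
      have "real_of_int \<bar>i - k\<bar> \<le> real_of_int (int n)" using ik by (simp only: of_int_le_iff)
      then have "\<bar>real_of_int k - of_int i\<bar> / 2 ^ j \<le> (real n + 1) / 2 ^ j"
        by (intro divide_right_mono) auto
      moreover have "t - of_int i / 2 ^ j = (real_of_int k - of_int i) / 2 ^ j"
        by (simp add: t_def diff_divide_distrib)
      ultimately show "\<bar>t - of_int i / 2 ^ j\<bar> \<le> (real n + 1) / 2 ^ j" by (simp add: abs_divide)
    qed
    ultimately show "\<bar>s j i - s j k\<bar> \<le> \<epsilon>" by linarith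
  qed
qed

section \<open>Regularity of the normal re-parametrization\<close>

text \<open>With \<open>r = 2 ^ -n\<close> the invariant is \<open>\<epsilon> * r * (2 - r)\<close>.
  Halving it falls short of its next value by exactly \<open>\<epsilon> * r\<^sup>2 / 4\<close>, and
  this room absorbs the cubic term, which is at most \<open>8 * C * \<epsilon> ^ 3 * r ^ 3\<close>;
  hence the 32 in the hypothesis.\<close>

lemma cubic_recursion_decay:
  fixes x :: "nat \<Rightarrow> int \<Rightarrow> real"
  assumes "0 \<le> C" "0 < \<epsilon>" "32 * C * \<epsilon>\<^sup>2 \<le> 1" and init: "\<And>i. \<bar>fdiff (x j0) i\<bar> \<le> \<epsilon>"
    and step: "\<And>j h K. j0 \<le> j \<Longrightarrow> (\<And>i. \<bar>fdiff (x j) i\<bar> \<le> h) \<Longrightarrow> \<bar>fdiff (x (Suc j)) K\<bar> \<le> h / 2 + C * h ^ 3"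
    and "j0 \<le> j"
  shows "\<bar>fdiff (x j) i\<bar> \<le> 2 * \<epsilon> * 2 ^ j0 / 2 ^ j"
proof -
  have bound: "\<bar>fdiff (x (j0 + n)) i\<bar> \<le> \<epsilon> * (1 / 2 ^ n) * (2 - 1 / 2 ^ n)" for n i
  proof (induction n arbitrary: i)
    case (Suc n)
    define r :: real where "r = 1 / 2 ^ n"
    define h where "h = \<epsilon> * r * (2 - r)"
    have r: "0 < r" "r \<le> 1" by (auto simp: r_def)
    have "\<bar>fdiff (x (Suc (j0 + n))) i\<bar> \<le> h / 2 + C * h ^ 3"
      using Suc.IH by (intro step) (auto simp: h_def r_def)
    also have "C * h ^ 3 \<le> C * (\<epsilon> * r * 2) ^ 3"
      unfolding h_def using r \<open>0 \<le> C\<close> \<open>0 < \<epsilon>\<close> by (intro mult_left_mono power_mono mult_nonneg_nonneg) auto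
    also have "\<dots> = (32 * C * \<epsilon>\<^sup>2) * (\<epsilon> * r ^ 3 / 4)" by (simp add: power2_eq_square power3_eq_cube)
    also have "\<dots> \<le> 1 * (\<epsilon> * r ^ 3 / 4)" using r \<open>0 < \<epsilon>\<close> assms(3) by (intro mult_right_mono) auto
    also have "\<dots> \<le> \<epsilon> * r ^ 2 / 4"
      using r \<open>0 < \<epsilon>\<close> by (auto intro!: mult_left_mono power_decreasing)
    also have "h / 2 + \<epsilon> * r ^ 2 / 4 = \<epsilon> * (r / 2) * (2 - r / 2)"
      by (simp add: h_def power2_eq_square field_simps)
    finally show ?case by (simp add: r_def mult_ac)
  qed (use init in auto)
  have "\<bar>fdiff (x j) i\<bar> \<le> \<epsilon> * (1 / 2 ^ (j - j0)) * (2 - 1 / 2 ^ (j - j0))"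
    using bound[of "j - j0" i] \<open>j0 \<le> j\<close> by simp
  also have "\<dots> \<le> \<epsilon> * (1 / 2 ^ (j - j0)) * 2"
    using \<open>0 < \<epsilon>\<close> by (intro mult_left_mono) auto
  also have "\<dots> = 2 * \<epsilon> * 2 ^ j0 / 2 ^ j"
    using \<open>j0 \<le> j\<close> by (simp add: power_diff)
  finally show ?thesis .
qed

context unit_speed_curve
begin

lemma lipschitz_v1: "norm (v1 x - v1 y) \<le> M * \<bar>x - y\<bar>"
  using norm_le_of_vderiv_le[of "\<lambda>x. v1 x - v1 y" v2 y M 0 x]
  by (simp add: norm_v2 deriv_v1 has_vector_derivative_diff_const)

lemma lipschitz_v2: "norm (v2 x - v2 y) \<le> M * \<bar>x - y\<bar>"
  using norm_le_of_vderiv_le[of "\<lambda>x. v2 x - v2 y" v3 y M 0 x]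
  by (simp add: norm_v3 deriv_v2 has_vector_derivative_diff_const)

lemma lipschitz_v3: "norm (v3 x - v3 y) \<le> M * \<bar>x - y\<bar>"
  using norm_le_of_vderiv_le[of "\<lambda>x. v3 x - v3 y" v4 y M 0 x]
  by (simp add: norm_v4 deriv_v3 has_vector_derivative_diff_const)

text \<open>The third derivative is a polynomial in the derivatives of \<open>\<sigma>\<close> and
  in \<open>v1\<close>, \<open>v2\<close>, \<open>v3\<close> along \<open>\<sigma>\<close>. The
  bound on \<open>v4\<close> makes \<open>v3\<close> Lipschitz, so its composition with the
  Lipschitz function \<open>\<sigma>\<close> is Hoelder for every exponent below 1.\<close>

lemma composition_C_3_holder:
  assumes d0: "\<And>t. (\<sigma> has_real_derivative \<sigma>1 t) (at t)"
    and d1: "\<And>t. (\<sigma>1 has_real_derivative \<sigma>2 t) (at t)"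
    and d2: "\<And>t. (\<sigma>2 has_real_derivative \<sigma>3 t) (at t)"
    and bh: "bounded_holder \<alpha> \<sigma>1" "bounded_holder \<alpha> \<sigma>2" "bounded_holder \<alpha> \<sigma>3"
    and \<alpha>: "0 < \<alpha>" "\<alpha> < 1"
  shows "C_k_holder 3 \<alpha> (\<lambda>t. v (\<sigma> t))"
proof -
  obtain \<Lambda> where \<Lambda>: "\<And>t. \<bar>\<sigma>1 t\<bar> \<le> \<Lambda>"
    using bh(1) unfolding bounded_holder_def bounded_iff by auto
  have lip: "\<bar>\<sigma> x - \<sigma> y\<bar> \<le> \<Lambda> * \<bar>x - y\<bar>" for x y
    using norm_le_of_vderiv_le[of "\<lambda>x. \<sigma> x - \<sigma> y" \<sigma>1 y \<Lambda> 0 x] d0 \<Lambda>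
    by (simp add: has_real_derivative_iff_has_vector_derivative has_vector_derivative_diff_const)
  have norm_v1': "norm (v1 t) \<le> M" for t using norm_v1 M_ge_1 by simp
  have bh_v1: "bounded_holder \<alpha> (\<lambda>t. v1 (\<sigma> t))"
    by (rule bounded_holder_compose_lipschitz[OF norm_v1' lipschitz_v1 lip \<alpha>])
  have bh_v2: "bounded_holder \<alpha> (\<lambda>t. v2 (\<sigma> t))"
    by (rule bounded_holder_compose_lipschitz[OF norm_v2 lipschitz_v2 lip \<alpha>])
  have bh_v3: "bounded_holder \<alpha> (\<lambda>t. v3 (\<sigma> t))"
    by (rule bounded_holder_compose_lipschitz[OF norm_v3 lipschitz_v3 lip \<alpha>])
  have chain: "((\<lambda>t. g (\<sigma> t)) has_vector_derivative \<sigma>1 t *\<^sub>R g') (at t)"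
    if "(g has_vector_derivative g') (at (\<sigma> t))" for g :: "real \<Rightarrow> 'a" and g' t
    using vector_diff_chain_at[of \<sigma> "\<sigma>1 t" t g g'] d0 that
    by (simp add: has_real_derivative_iff_has_vector_derivative o_def)
  define f0 where "f0 t = v (\<sigma> t)" for t
  define f1 where "f1 t = \<sigma>1 t *\<^sub>R v1 (\<sigma> t)" for t
  define f2 where "f2 t = \<sigma>2 t *\<^sub>R v1 (\<sigma> t) + (\<sigma>1 t * \<sigma>1 t) *\<^sub>R v2 (\<sigma> t)" for t
  define f3 where "f3 t = \<sigma>3 t *\<^sub>R v1 (\<sigma> t) + (3 * (\<sigma>1 t * \<sigma>2 t)) *\<^sub>R v2 (\<sigma> t)
    + (\<sigma>1 t * (\<sigma>1 t * \<sigma>1 t)) *\<^sub>R v3 (\<sigma> t)" for t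
  define f where "f k = [f0, f1, f2, f3] ! k" for k
  have D0: "(f0 has_vector_derivative f1 t) (at t)" for t
    unfolding f0_def[abs_def] f1_def by (rule chain[OF deriv_v])
  have D1: "(f1 has_vector_derivative f2 t) (at t)" for t
  proof -
    have "(f1 has_vector_derivative \<sigma>1 t *\<^sub>R (\<sigma>1 t *\<^sub>R v2 (\<sigma> t)) + \<sigma>2 t *\<^sub>R v1 (\<sigma> t)) (at t)"
      unfolding f1_def[abs_def] by (rule has_vector_derivative_scaleR[OF d1 chain[OF deriv_v1]])
    then show ?thesis by (simp add: f2_def add.commute)
  qed
  have D2: "(f2 has_vector_derivative f3 t) (at t)" for t
  proof -
    have "((\<lambda>t. \<sigma>1 t * \<sigma>1 t) has_real_derivative 2 * (\<sigma>1 t * \<sigma>2 t)) (at t)"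
      by (auto intro!: derivative_eq_intros d1)
    then have "(f2 has_vector_derivative (\<sigma>2 t *\<^sub>R (\<sigma>1 t *\<^sub>R v2 (\<sigma> t)) + \<sigma>3 t *\<^sub>R v1 (\<sigma> t))
        + ((\<sigma>1 t * \<sigma>1 t) *\<^sub>R (\<sigma>1 t *\<^sub>R v3 (\<sigma> t)) + (2 * (\<sigma>1 t * \<sigma>2 t)) *\<^sub>R v2 (\<sigma> t))) (at t)"
      unfolding f2_def[abs_def]
      by (intro has_vector_derivative_add has_vector_derivative_scaleR d2 chain deriv_v1 deriv_v2)
    moreover have "(3 * (\<sigma>1 t * \<sigma>2 t)) *\<^sub>R v2 (\<sigma> t)
        = (2 * (\<sigma>1 t * \<sigma>2 t)) *\<^sub>R v2 (\<sigma> t) + (\<sigma>1 t * \<sigma>2 t) *\<^sub>R v2 (\<sigma> t)"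
      unfolding scaleR_left.add[symmetric] by simp
    ultimately show ?thesis by (simp add: f3_def mult_ac add_ac)
  qed
  have der: "(f k has_vector_derivative f (Suc k) t) (at t)" if "k < 3" for k t
  proof -
    have "k = 0 \<or> k = 1 \<or> k = 2" using that by auto
    then show ?thesis using D0 D1 D2 by (auto simp: f_def numeral_2_eq_2)
  qed
  have f3: "bounded_holder \<alpha> (f 3)"
    using bh bh_v1 bh_v2 bh_v3 unfolding f_def
    by (simp add: numeral_3_eq_3 f3_def[abs_def])
      (intro bounded_holder_add bounded_holder_scaleR bounded_holder_mult bounded_holder_const)
  then have "continuous_on UNIV (f 3)"
    using \<alpha> by (auto simp: bounded_holder_def continuous_on_eq_continuous_at intro: holder_imp_continuous)
  then have "C_k 3 (f 0)" by (intro C_k_of_derivatives der)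
  moreover have "nth_vderiv 3 (f 0) = f 3" using nth_vderiv_eq[where f = f and n = 3 and k = 3] der by blast
  moreover have "f 0 = (\<lambda>t. v (\<sigma> t))" by (simp add: f_def f0_def[abs_def])
  ultimately show ?thesis using f3 by (simp add: C_k_holder_def bounded_holder_def)
qed

text \<open>A bootstrap: the cubic estimate gives increments \<open>O(2 ^ -j)\<close> and errors
  \<open>O(8 ^ -j)\<close>, these give second differences \<open>O(4 ^ -j)\<close>, and the refined
  estimate turns them into \<open>O(16 ^ -j)\<close>. The third bound on \<open>\<epsilon>\<close>
  starts the decay of the increments.\<close>

lemma normal_transform_fourth_order:
  assumes "3 \<le> p" and mono: "\<And>j. strict_mono (s j)"
    and orth: "\<And>j K. (subdiv p (\<lambda>i. v (s j i)) K - v (s (Suc j) K)) \<bullet> subdiv (p - 2) (fdiff (\<lambda>i. v (s j i))) K = 0"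
    and nz: "\<And>j K. subdiv (p - 2) (fdiff (\<lambda>i. v (s j i))) K \<noteq> 0"
    and \<epsilon>: "0 < \<epsilon>" "\<epsilon> \<le> 1 / (2 ^ (p + 4) * M)" "\<epsilon> \<le> 1 / (32 * (270 * step_const p * (real p) ^ 3 + 1))"
    and near: "\<And>j K. j0 \<le> j \<Longrightarrow> \<bar>s (Suc j) K - s j (K div 2)\<bar> \<le> \<epsilon>"
    and span: "\<And>j i k. j0 \<le> j \<Longrightarrow> \<bar>i - k\<bar> \<le> int p \<Longrightarrow> \<bar>s j i - s j k\<bar> \<le> \<epsilon>"
  obtains E where "0 \<le> E" "\<And>j K. j0 \<le> j \<Longrightarrow> \<bar>s (Suc j) K - subdiv p (s j) K\<bar> \<le> E / 16 ^ j"
proof -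
  have "2 \<le> p" using \<open>3 \<le> p\<close> by simp
  define Q where "Q = 135 * step_const p"
  have "0 \<le> Q" by (simp add: Q_def step_const_nonneg)
  define H where "H j K = s j ((K + int p) div 2) - s j (K div 2)" for j K
  have gap: "0 \<le> (K + int p) div 2 - K div 2" "(K + int p) div 2 - K div 2 \<le> int p" for K
    using \<open>3 \<le> p\<close> by linarith+
  have H_nonneg: "0 \<le> H j K" for j K
    using gap[of K] strict_mono_mono[OF mono[of j]] by (simp add: H_def monoD)
  have H_small: "H j K \<le> 1 / (2 ^ (p + 4) * M)" if "j0 \<le> j" for j K
  proof -
    have "\<bar>H j K\<bar> \<le> \<epsilon>" unfolding H_def using gap[of K] by (intro span that) simp
    then show ?thesis using \<epsilon>(2) by linarith
  qed
  have near': "\<bar>s (Suc j) K - s j (K div 2)\<bar> \<le> 1 / (2 ^ (p + 4) * M)" if "j0 \<le> j" for j K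
    using near[OF that] \<epsilon>(2) by (rule order_trans)
  have H_le: "H j K \<le> real p * h" if "\<And>i. \<bar>fdiff (s j) i\<bar> \<le> h" for j K h
  proof -
    define n where "n = nat ((K + int p) div 2 - K div 2)"
    have "0 \<le> h" using that[of 0] by linarith
    have "\<bar>s j (K div 2 + int n) - s j (K div 2) - real n * 0\<bar> \<le> real n * h"
      by (rule abs_diff_le_of_fdiff) (use that in simp)
    moreover have "K div 2 + int n = (K + int p) div 2" using gap[of K] by (simp add: n_def)
    ultimately have "H j K \<le> real n * h" by (simp add: H_def)
    also have "\<dots> \<le> real p * h" using gap[of K] \<open>0 \<le> h\<close> by (intro mult_right_mono) (auto simp: n_def)
    finally show ?thesis .
  qed
  have cubic: "\<bar>s (Suc j) K - subdiv p (s j) K\<bar> \<le> Q * (real p * h) ^ 3"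
    if "j0 \<le> j" "\<And>i. \<bar>fdiff (s j) i\<bar> \<le> h" for j K h
  proof -
    have "\<bar>subdiv p (s j) K - s (Suc j) K\<bar> \<le> Q * H j K ^ 3"
      unfolding Q_def
      by (rule normal_step_cubic[OF \<open>2 \<le> p\<close> mono orth nz H_def[of j K] H_small[OF that(1)] near'[OF that(1)]])
    also have "\<dots> \<le> Q * (real p * h) ^ 3"
      using H_le[OF that(2)] by (intro mult_left_mono power_mono H_nonneg \<open>0 \<le> Q\<close>)
    finally show ?thesis by (simp add: abs_minus_commute)
  qed
  \<comment> \<open>Twice the cubic error, since a difference sees the errors at both of its ends.
    The condition on \<open>\<epsilon>\<close> involves \<open>C + 1\<close> so that it yields
    \<open>32 * C * \<epsilon> \<le> 1\<close> and \<open>\<epsilon> \<le> 1\<close>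
    together.\<close>
  define C where "C = 2 * Q * (real p) ^ 3"
  have "0 \<le> C" using \<open>0 \<le> Q\<close> by (simp add: C_def)
  have small: "32 * C * \<epsilon>\<^sup>2 \<le> 1"
  proof -
    have "\<epsilon> \<le> 1 / (32 * (C + 1))" using \<epsilon>(3) by (simp add: C_def Q_def)
    then have *: "32 * (C + 1) * \<epsilon> \<le> 1" using \<open>0 \<le> C\<close> by (simp add: field_simps)
    have "0 \<le> C * \<epsilon>" using \<open>0 \<le> C\<close> \<epsilon>(1) by simp
    then have "32 * (C * \<epsilon>) \<le> 1" "\<epsilon> \<le> 1" using * \<epsilon>(1) by (auto simp: algebra_simps)
    then have "(32 * (C * \<epsilon>)) * \<epsilon> \<le> 1 * 1" using \<epsilon>(1) by (intro mult_mono) auto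
    then show ?thesis by (simp add: power2_eq_square mult_ac)
  qed
  have init: "\<bar>fdiff (s j0) i\<bar> \<le> \<epsilon>" for i
    unfolding fdiff_def using \<open>3 \<le> p\<close> by (intro span) auto
  have step: "\<bar>fdiff (s (Suc j)) K\<bar> \<le> h / 2 + C * h ^ 3"
    if "j0 \<le> j" and h: "\<And>i. \<bar>fdiff (s j) i\<bar> \<le> h" for j h K
  proof -
    define e where "e i = s (Suc j) i - subdiv p (s j) i" for i
    have p: "p = Suc (p - 1)" using \<open>3 \<le> p\<close> by simp
    have "fdiff (s (Suc j)) K = fdiff (subdiv p (s j)) K + (e (K + 1) - e K)"
      by (simp add: e_def fdiff_def)
    also have "fdiff (subdiv p (s j)) K = (1 / 2) * subdiv (p - 1) (fdiff (s j)) K"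
      using fdiff_subdiv_Suc[of "p - 1" "s j" K] p by simp
    finally have eq: "fdiff (s (Suc j)) K = (1 / 2) * subdiv (p - 1) (fdiff (s j)) K + (e (K + 1) - e K)" .
    have "\<bar>subdiv (p - 1) (fdiff (s j)) K\<bar> \<le> h"
      using norm_subdiv_le[of K "p - 1" "fdiff (s j)" h] h by simp
    moreover have "\<bar>e i\<bar> \<le> Q * (real p * h) ^ 3" for i
      unfolding e_def by (rule cubic[OF that])
    ultimately have "\<bar>fdiff (s (Suc j)) K\<bar> \<le> h / 2 + (Q * (real p * h) ^ 3 + Q * (real p * h) ^ 3)"
      unfolding eq by (intro order_trans[OF abs_triangle_ineq] add_mono order_trans[OF abs_triangle_ineq4]) auto
    then show ?thesis by (simp add: C_def power_mult_distrib mult_ac)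
  qed
  have \<Delta>: "\<bar>fdiff (s j) i\<bar> \<le> 2 * \<epsilon> * 2 ^ j0 / 2 ^ j" if "j0 \<le> j" for j i
    by (rule cubic_recursion_decay[OF \<open>0 \<le> C\<close> \<epsilon>(1) small init step that])
  define b where "b = 2 * \<epsilon> * 2 ^ j0"
  have "0 < b" using \<epsilon>(1) by (simp add: b_def)
  define E3 where "E3 = Q * (real p * b) ^ 3"
  have "0 \<le> E3" using \<open>0 \<le> Q\<close> \<open>0 < b\<close> by (simp add: E3_def)
  have e3: "\<bar>s (Suc j) K - subdiv p (s j) K\<bar> \<le> E3 / 8 ^ j" if "j0 \<le> j" for j K
  proof -
    have "\<bar>s (Suc j) K - subdiv p (s j) K\<bar> \<le> Q * (real p * (b / 2 ^ j)) ^ 3"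
      by (rule cubic[OF that]) (use \<Delta>[OF that] in \<open>simp add: b_def\<close>)
    also have "\<dots> = E3 / (2 ^ j) ^ 3" by (simp add: E3_def power_divide power_mult_distrib)
    also have "(2 ^ j) ^ 3 = (8::real) ^ j" by (simp add: power_mult[symmetric] mult.commute[of j]) (simp add: power_mult)
    finally show ?thesis .
  qed
  \<comment> \<open>Scaling by \<open>4 ^ j\<close> turns errors of size \<open>8 ^ -j\<close> into
    a summable perturbation, so the scaled second differences stay bounded.\<close>
  define D where "D j i = 2 ^ (2 * j) * (fdiff ^^ 2) (s j) i" for j i
  have "\<bar>D j i\<bar> \<le> 2 ^ (2 * j0) * (2 * \<epsilon>) + 2 * (16 * E3)" if "j0 \<le> j" for j i
  proof (rule perturbed_subdiv_bounded[OF _ _ _ that])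
    show "0 \<le> 16 * E3" using \<open>0 \<le> E3\<close> by simp
    show "\<bar>D j0 i\<bar> \<le> 2 ^ (2 * j0) * (2 * \<epsilon>)" for i
    proof -
      have "\<bar>(fdiff ^^ 1) (fdiff (s j0)) i\<bar> \<le> 2 ^ 1 * \<epsilon>"
        by (rule abs_funpow_fdiff_le) (unfold fdiff_def, use \<open>3 \<le> p\<close> in \<open>intro span; simp\<close>)
      then show ?thesis by (simp add: D_def abs_mult numeral_2_eq_2)
    qed
    show "\<bar>D (Suc j) K - subdiv (p - 2) (D j) K\<bar> \<le> 16 * E3 / 2 ^ j" if "j0 \<le> j" for j K
    proof -
      have "\<bar>D (Suc j) K - subdiv (p - 2) (D j) K\<bar> \<le> 2 ^ (2 * j) * 4 ^ 2 * (E3 / 8 ^ j)"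
        unfolding D_def[abs_def] using \<open>3 \<le> p\<close> by (intro scaled_fdiff_step e3 that) simp
      also have "(8::real) ^ j = 2 ^ (2 * j) * 2 ^ j" by (simp add: power_mult power_mult_distrib[symmetric])
      finally show ?thesis by simp
    qed
  qed
  moreover define B where "B = 2 ^ (2 * j0) * (2 * \<epsilon>) + 2 * (16 * E3)"
  ultimately have D_le: "\<bar>D j i\<bar> \<le> B" if "j0 \<le> j" for j i using that by simp
  have \<Delta>2: "\<bar>fdiff (fdiff (s j)) i\<bar> \<le> B / 4 ^ j" if "j0 \<le> j" for j i
  proof -
    have "(fdiff ^^ 2) (s j) i = fdiff (fdiff (s j)) i" by (simp add: numeral_2_eq_2)
    then have "D j i = 4 ^ j * fdiff (fdiff (s j)) i" by (simp add: D_def power_mult)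
    then show ?thesis using D_le[OF that, of i] by (simp add: abs_mult field_simps)
  qed
  have "0 \<le> B" using \<epsilon>(1) \<open>0 \<le> E3\<close> by (simp add: B_def)
  define E where "E = step_const' p * ((real p * b)\<^sup>2 * B + (real p * b) ^ 4)"
  show ?thesis
  proof (rule that)
    show "0 \<le> E" unfolding E_def using \<open>0 \<le> B\<close> \<open>0 < b\<close> step_const'_nonneg by simp
    fix j K assume j: "j0 \<le> j"
    have H: "H j K \<le> real p * b / 2 ^ j"
      using H_le[of j "b / 2 ^ j" K] \<Delta>[OF j] by (simp add: b_def)
    have "\<bar>subdiv p (s j) K - s (Suc j) K\<bar> \<le> step_const' p * ((H j K)\<^sup>2 * (B / 4 ^ j) + H j K ^ 4)"
      by (rule normal_step_refined[OF \<open>3 \<le> p\<close> mono orth nz H_def[of j K] H_small[OF j] near'[OF j] \<Delta>2[OF j]])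
    also have "\<dots> \<le> step_const' p * ((real p * b / 2 ^ j)\<^sup>2 * (B / 4 ^ j) + (real p * b / 2 ^ j) ^ 4)"
      using H \<open>0 \<le> B\<close> by (intro mult_left_mono add_mono mult_right_mono power_mono H_nonneg step_const'_nonneg) auto
    also have "\<dots> = E / 16 ^ j"
    proof -
      have "((2::real) ^ j)\<^sup>2 = 4 ^ j" "((2::real) ^ j) ^ 4 = 16 ^ j" "(4::real) ^ j * 4 ^ j = 16 ^ j"
        by (simp_all add: power_mult[symmetric] power_mult_distrib[symmetric] mult.commute[of j])
          (simp_all add: power_mult)
      then show ?thesis by (simp add: E_def power_divide add_divide_distrib[symmetric])
    qed
    finally show "\<bar>s (Suc j) K - subdiv p (s j) K\<bar> \<le> E / 16 ^ j" by (simp add: abs_minus_commute)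
  qed
qed

end

section \<open>From periodicity to uniform bounds on the derivatives of the curve\<close>

lemma nth_vderiv_periodic:
  assumes "C_k n f" "\<And>t. f (t + L) = f t" "k \<le> n"
  shows "nth_vderiv k f (t + L) = nth_vderiv k f t"
  using \<open>k \<le> n\<close>
proof (induction k arbitrary: t)
  case (Suc k)
  have "(nth_vderiv k f has_vector_derivative nth_vderiv (Suc k) f (t + L)) (at (t + L))"
    using Suc.prems by (intro C_k_has_vector_derivative[OF assms(1)]) simp
  then have "((\<lambda>t. nth_vderiv k f (t + L)) has_vector_derivative nth_vderiv (Suc k) f (t + L)) (at t)"
    using vector_diff_chain_at[of "\<lambda>t. t + L" 1 t "nth_vderiv k f"]
    by (simp add: o_def has_vector_derivative_add_const)
  moreover have "(\<lambda>t. nth_vderiv k f (t + L)) = nth_vderiv k f" using Suc by simp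
  moreover have "(nth_vderiv k f has_vector_derivative nth_vderiv (Suc k) f t) (at t)"
    using Suc.prems by (intro C_k_has_vector_derivative[OF assms(1)]) simp
  ultimately show ?case by (metis vector_derivative_unique_at)
qed (simp add: nth_vderiv_def assms(2))

lemma C_k_periodic_bounded:
  assumes "C_k n f" "\<And>t. f (t + L) = f t" "0 < L" "k \<le> n"
  obtains M where "\<And>t. norm (nth_vderiv k f t) \<le> M"
proof -
  have "continuous_on UNIV (nth_vderiv k f)"
  proof (cases "k = n")
    case True
    then show ?thesis using \<open>C_k n f\<close> by (simp add: C_k_def)
  next
    case False
    then have "k < n" using \<open>k \<le> n\<close> by simp
    then have "isCont (nth_vderiv k f) t" for t
      using C_k_has_vector_derivative[OF \<open>C_k n f\<close>] has_vector_derivative_continuous by blast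
    then show ?thesis by (simp add: continuous_on_eq_continuous_at)
  qed
  then show ?thesis
    using periodic_continuous_bounded[of "nth_vderiv k f" L] nth_vderiv_periodic[OF assms(1,2,4)] \<open>0 < L\<close> that
    by blast
qed

lemma closed_C_4_curve_unit_speed:
  assumes "closed_arclength_curve v L" "C_k 4 v"
  obtains M where "unit_speed_curve v (nth_vderiv 1 v) (nth_vderiv 2 v) (nth_vderiv 3 v) (nth_vderiv 4 v) M"
proof -
  have per: "\<And>t. v (t + L) = v t" and "0 < L" and unit: "\<And>t. norm (vector_derivative v (at t)) = 1"
    using assms(1) by (auto simp: closed_arclength_curve_def)
  have bound: "\<exists>M. \<forall>t. norm (nth_vderiv k v t) \<le> M" if "k \<le> 4" for k
    using C_k_periodic_bounded[OF assms(2) per \<open>0 < L\<close> that] by blast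
  obtain M2 M3 M4 where M: "\<And>t. norm (nth_vderiv 2 v t) \<le> M2"
      "\<And>t. norm (nth_vderiv 3 v t) \<le> M3" "\<And>t. norm (nth_vderiv 4 v t) \<le> M4"
    using bound[of 2] bound[of 3] bound[of 4] by auto
  define M where "M = max 1 (max M2 (max M3 M4))"
  have der: "(nth_vderiv k v has_vector_derivative nth_vderiv (Suc k) v t) (at t)" if "k < 4" for k t
    using C_k_has_vector_derivative[OF assms(2) that] .
  show ?thesis
  proof (rule that, unfold_locales)
    fix t
    show "(v has_vector_derivative nth_vderiv 1 v t) (at t)" using der[of 0 t] by (simp add: nth_vderiv_def)
    show "(nth_vderiv 1 v has_vector_derivative nth_vderiv 2 v t) (at t)"
      using der[of 1 t] by (simp add: numeral_2_eq_2)
    show "(nth_vderiv 2 v has_vector_derivative nth_vderiv 3 v t) (at t)"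
      using der[of 2 t] by (simp add: numeral_3_eq_3 numeral_2_eq_2)
    show "(nth_vderiv 3 v has_vector_derivative nth_vderiv 4 v t) (at t)"
      using der[of 3 t] by simp
    show "norm (nth_vderiv 1 v t) = 1" using unit[of t] by (simp add: nth_vderiv_def)
    show "norm (nth_vderiv 2 v t) \<le> M" using M(1)[of t] by (simp add: M_def)
    show "norm (nth_vderiv 3 v t) \<le> M" using M(2)[of t] by (simp add: M_def)
    show "norm (nth_vderiv 4 v t) \<le> M" using M(3)[of t] by (simp add: M_def)
    show "1 \<le> M" by (simp add: M_def)
  qed
qed

theorem theorem3p4:
  fixes p N :: nat and L :: real
    and v :: "real \<Rightarrow> complex" and v0 :: "int \<Rightarrow> complex"
    and s d :: "nat \<Rightarrow> int \<Rightarrow> real" and vv :: "nat \<Rightarrow> int \<Rightarrow> complex"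
    and \<sigma> :: "real \<Rightarrow> real"
  assumes "p \<ge> 4"
    and "closed_arclength_curve v L"
    and "C_k 4 v"
    and "normal_transform p v L N v0 s vv d"
    and "well_posed p s vv"
    and "converges_to s \<sigma>"
  shows "C_k_1minus 3 (normal_reparametrization v \<sigma>)"
proof -
  obtain M where "unit_speed_curve v (nth_vderiv 1 v) (nth_vderiv 2 v) (nth_vderiv 3 v) (nth_vderiv 4 v) M"
    using closed_C_4_curve_unit_speed[OF assms(2,3)] .
  then interpret unit_speed_curve v "nth_vderiv 1 v" "nth_vderiv 2 v" "nth_vderiv 3 v" "nth_vderiv 4 v" M .
  have "0 < N" and shift: "\<And>j i. s j (i + 2 ^ j * int N) = s j i + L"
    and vv_step: "\<And>j K. vv (Suc j) K = subdiv p (vv j) K + d (Suc j) K *\<^sub>R unit_normal p (vv j) K"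
    using assms(4) unfolding normal_transform_def initial_data_def by blast+
  have vv: "vv j = (\<lambda>i. v (s j i))" for j
    using assms(4) unfolding normal_transform_def initial_data_def by (cases j) auto
  have mono: "strict_mono (s j)" for j
    using assms(5) by (simp add: well_posed_def)
  have nz: "subdiv (p - 2) (fdiff (\<lambda>i. v (s j i))) K \<noteq> 0" for j K
    using assms(5) by (simp add: well_posed_def flip: vv)
  \<comment> \<open>The new point moves along the normal only, so the detail \<open>d\<close> drops
    out. \<open>perp\<close> multiplies by the imaginary unit, and \<open>\<i> * z\<close> is
    orthogonal to \<open>z\<close> in the real inner product.\<close>
  have orth: "(subdiv p (\<lambda>i. v (s j i)) K - v (s (Suc j) K)) \<bullet> subdiv (p - 2) (fdiff (\<lambda>i. v (s j i))) K = 0" for j K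
  proof -
    have "subdiv p (vv j) K - vv (Suc j) K = - (d (Suc j) K *\<^sub>R unit_normal p (vv j) K)"
      unfolding vv_step by simp
    moreover have "unit_normal p (vv j) K \<bullet> subdiv (p - 2) (fdiff (vv j)) K = 0"
      by (simp add: unit_normal_def perp_def inner_complex_def)
    ultimately have "(subdiv p (vv j) K - vv (Suc j) K) \<bullet> subdiv (p - 2) (fdiff (vv j)) K = 0" by simp
    then show ?thesis by (simp add: vv)
  qed
  \<comment> \<open>The first entry keeps each step inside the range of the local expansion, the
    second makes the recursion for the increments contract.\<close>
  define \<epsilon> where "\<epsilon> = min (1 / (2 ^ (p + 4) * M)) (1 / (32 * (270 * step_const p * (real p) ^ 3 + 1)))"
  have "0 < \<epsilon>"
  proof -
    have "0 < 2 ^ (p + 4) * M" using M_ge_1 by simp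
    moreover have "0 \<le> 270 * step_const p * (real p) ^ 3" using step_const_nonneg by simp
    ultimately show ?thesis by (simp add: \<epsilon>_def)
  qed
  obtain j0 where near: "\<And>j K. j0 \<le> j \<Longrightarrow> \<bar>s (Suc j) K - s j (K div 2)\<bar> \<le> \<epsilon>"
    and span: "\<And>j i k. j0 \<le> j \<Longrightarrow> \<bar>i - k\<bar> \<le> int p \<Longrightarrow> \<bar>s j i - s j k\<bar> \<le> \<epsilon>"
    using nodes_close[where s = s, OF assms(6) \<open>0 < N\<close> shift \<open>0 < \<epsilon>\<close>, of p] by blast
  have "3 \<le> p" using \<open>p \<ge> 4\<close> by simp
  have \<epsilon>_le: "\<epsilon> \<le> 1 / (2 ^ (p + 4) * M)" "\<epsilon> \<le> 1 / (32 * (270 * step_const p * (real p) ^ 3 + 1))"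
    by (simp_all add: \<epsilon>_def)
  obtain E where E: "0 \<le> E" "\<And>j K. j0 \<le> j \<Longrightarrow> \<bar>s (Suc j) K - subdiv p (s j) K\<bar> \<le> E / 16 ^ j"
    using normal_transform_fourth_order[where s = s, OF \<open>3 \<le> p\<close> mono orth nz \<open>0 < \<epsilon>\<close> \<epsilon>_le near span] by blast
  have "\<bar>fdiff (s j0) i\<bar> \<le> \<epsilon>" for i
    unfolding fdiff_def using \<open>p \<ge> 4\<close> by (intro span) auto
  from perturbed_subdiv_limit_smooth[where x = s, OF \<open>p \<ge> 4\<close> E(1) this E(2)
      nodes_tendsto_limit[where s = s, OF assms(6) \<open>0 < N\<close> shift]]
  obtain G where G0: "G 0 = \<sigma>"
    and der: "\<And>k t. k < 3 \<Longrightarrow> (G k has_real_derivative G (Suc k) t) (at t)"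
    and bdd: "\<And>k. 1 \<le> k \<Longrightarrow> k \<le> 3 \<Longrightarrow> bounded (range (G k))"
    and holder: "\<And>k \<alpha>. 1 \<le> k \<Longrightarrow> k \<le> 3 \<Longrightarrow> 0 < \<alpha> \<Longrightarrow> \<alpha> < 1 \<Longrightarrow> holder_continuous \<alpha> (G k)"
    by blast
  have "C_k_holder 3 \<alpha> (\<lambda>t. v (\<sigma> t))" if \<alpha>: "0 < \<alpha>" "\<alpha> < 1" for \<alpha>
  proof (rule composition_C_3_holder[OF _ _ _ _ _ _ \<alpha>])
    show "(\<sigma> has_real_derivative G 1 t) (at t)" for t using der[of 0 t] G0 by simp
    show "(G 1 has_real_derivative G 2 t) (at t)" for t using der[of 1 t] by (simp add: numeral_2_eq_2)
    show "(G 2 has_real_derivative G 3 t) (at t)" for t using der[of 2 t] by (simp add: numeral_3_eq_3 numeral_2_eq_2)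
    show "bounded_holder \<alpha> (G 1)" "bounded_holder \<alpha> (G 2)" "bounded_holder \<alpha> (G 3)"
      using bdd holder \<alpha> by (auto simp: bounded_holder_def)
  qed
  then show ?thesis by (simp add: C_k_1minus_def normal_reparametrization_def)
qed

end
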